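(* Let $\mathcal{D}$ be a $C^1_c(\mathbb{R}^2)$-stable algebra of bounded real-valued functions on a nonempty set $X$ containing a strictly positive function $\chi>0$, and let $(\mathcal{E},\mathcal{D})$ be a sup-norm-closable bilinear form on which normal contractions operate. Let $m$ be a finite energy dominant measure for $(\mathcal{E},\mathcal{D})$, and denote also by $m$ its unique extension to $\sigma(\mathcal{D})$. Then $(\mathcal{E},\mathcal{D})$ is closable on $L_2(X,\sigma(\mathcal{D}),m)$, i.e. whenever $(f_n)_n\subset\mathcal{D}$ is $\mathcal{E}$-Cauchy and $f_n\to0$ in $L_2(X,m)$ one has $\mathcal{E}(f_n)\to0$. Its closure is a Dirichlet form on $L_2(X,m)$ which admits a carré du champ: for every $f\in\mathcal{D}$ the energy measure $\Gamma(f)$ extends to a measure on $\sigma(\mathcal{D})$ which has a density with respect to $m$ belonging to $L_1(X,m)$.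
   Context: All functions are bounded real-valued functions on a nonempty set $X$; spaces of such functions carry the supremum norm $\|f\|_{\sup}=\sup_{x\in X}|f(x)|$, and $\mathcal{D}^+$ denotes the nonnegative elements of $\mathcal{D}$. A bilinear form $(\mathcal{E},\mathcal{D})$ is a symmetric nonnegative definite bilinear map $\mathcal{E}:\mathcal{D}\times\mathcal{D}\to\mathbb{R}$; write $\mathcal{E}(f):=\mathcal{E}(f,f)$. A normal contraction is a map $F:\mathbb{R}\to\mathbb{R}$ with $F(0)=0$ and $|F(x)-F(y)|\le|x-y|$; normal contractions operate on $(\mathcal{E},\mathcal{D})$ if $F(f)\in\mathcal{D}$ and $\mathcal{E}(F(f))\le\mathcal{E}(f)$ for all $f\in\mathcal{D}$ and all normal contractions $F$. $(\mathcal{E},\mathcal{D})$ is sup-norm-closable if for every $\mathcal{E}$-Cauchy sequence $(f_n)\subset\mathcal{D}$ (i.e. $\mathcal{E}(f_n-f_m)\to0$) with $\|f_n\|_{\sup}\to0$ one has $\mathcal{E}(f_n)\to0$. $\mathcal{D}$ is $C^1_c(\mathbb{R}^2)$-stable if $\varphi(f,g)\in\mathcal{D}$ for all $f,g\in\mathcal{D}$ and all compactly supported $C^1$ functions $\varphi:\mathbb{R}^2\to\mathbb{R}$ with $\varphi(0)=0$. For $f,h\in\mathcal{D}$ put $L_f(h):=2\mathcal{E}(fh,f)-\mathcal{E}(f^2,h)$ (these functionals are positive under the hypotheses). Let $\mathcal{S}=\{\{f>0\}:f\in\mathcal{D}\}$, $\alpha(\mathcal{S})$ the algebra of subsets generated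 by $\mathcal{S}$, and $\sigma(\mathcal{D})$ the $\sigma$-algebra generated by $\mathcal{D}$. The energy measure of $f\in\mathcal{D}$ is the set function $\Gamma(f)(B):=\sup\{L_f(h):h\in\mathcal{D},0\le h\le\mathbf 1_B\}$ for $B\in\mathcal{S}$ and $\Gamma(f)(A):=\inf\{\Gamma(f)(B):B\in\mathcal{S},A\subset B\}$ for $A\subset X$, considered on $\alpha(\mathcal{S})$ (where it is finitely additive). A measure means a countably additive set function. A measure $m$ on $\alpha(\mathcal{S})$ is energy dominant for $(\mathcal{E},\mathcal{D})$ if for every $f\in\mathcal{D}$ and $\varepsilon>0$ there is $\delta>0$ such that $\Gamma(f)(A)<\varepsilon$ for all $A\in\alpha(\mathcal{S})$ with $m(A)<\delta$. *)

theory Defs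
  imports "HOL-Analysis.Analysis"
begin

text \<open>The underlying nonempty set X is the universe of the type 'a.\<close>

definition normal_contraction :: "(real \<Rightarrow> real) \<Rightarrow> bool" where
  "normal_contraction F \<longleftrightarrow> F 0 = 0 \<and> (\<forall>x y. \<bar>F x - F y\<bar> \<le> \<bar>x - y\<bar>)"

definition bounded_fun :: "('a \<Rightarrow> real) \<Rightarrow> bool" where
  "bounded_fun f \<longleftrightarrow> (\<exists>B. \<forall>x. \<bar>f x\<bar> \<le> B)"

definition sup_norm :: "('a \<Rightarrow> real) \<Rightarrow> real" where
  "sup_norm f = (SUP x. \<bar>f x\<bar>)"

definition bounded_fun_algebra :: "('a \<Rightarrow> real) set \<Rightarrow> bool" where
  "bounded_fun_algebra D \<longleftrightarrow>
     (\<forall>f\<in>D. bounded_fun f) \<and> (\<lambda>x. 0) \<in> D \<and>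
     (\<forall>f\<in>D. \<forall>g\<in>D. (\<lambda>x. f x + g x) \<in> D) \<and>
     (\<forall>f\<in>D. \<forall>c::real. (\<lambda>x. c * f x) \<in> D) \<and>
     (\<forall>f\<in>D. \<forall>g\<in>D. (\<lambda>x. f x * g x) \<in> D)"

definition C1c_R2 :: "(real \<times> real \<Rightarrow> real) \<Rightarrow> bool" where
  "C1c_R2 \<phi> \<longleftrightarrow>
     (\<exists>\<phi>' :: real \<times> real \<Rightarrow> ((real \<times> real) \<Rightarrow>\<^sub>L real).
        (\<forall>z. (\<phi> has_derivative blinfun_apply (\<phi>' z)) (at z)) \<and> continuous_on UNIV \<phi>') \<and>
     compact (closure {z. \<phi> z \<noteq> 0})"

definition C1c_stable :: "('a \<Rightarrow> real) set \<Rightarrow> bool" where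
  "C1c_stable D \<longleftrightarrow>
     (\<forall>f\<in>D. \<forall>g\<in>D. \<forall>\<phi>. C1c_R2 \<phi> \<and> \<phi> (0,0) = 0 \<longrightarrow> (\<lambda>x. \<phi> (f x, g x)) \<in> D)"

definition bilinear_form :: "(('a \<Rightarrow> real) \<Rightarrow> ('a \<Rightarrow> real) \<Rightarrow> real) \<Rightarrow> ('a \<Rightarrow> real) set \<Rightarrow> bool" where
  "bilinear_form E D \<longleftrightarrow>
     (\<forall>f\<in>D. \<forall>g\<in>D. E f g = E g f) \<and>
     (\<forall>f\<in>D. \<forall>g\<in>D. \<forall>h\<in>D. E (\<lambda>x. f x + g x) h = E f h + E g h) \<and>
     (\<forall>f\<in>D. \<forall>h\<in>D. \<forall>c::real. E (\<lambda>x. c * f x) h = c * E f h) \<and>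
     (\<forall>f\<in>D. E f f \<ge> 0)"

definition contractions_operate :: "(('a \<Rightarrow> real) \<Rightarrow> ('a \<Rightarrow> real) \<Rightarrow> real) \<Rightarrow> ('a \<Rightarrow> real) set \<Rightarrow> bool" where
  "contractions_operate E D \<longleftrightarrow>
     (\<forall>f\<in>D. \<forall>F. normal_contraction F \<longrightarrow> (F \<circ> f) \<in> D \<and> E (F \<circ> f) (F \<circ> f) \<le> E f f)"

definition E_Cauchy :: "(('a \<Rightarrow> real) \<Rightarrow> ('a \<Rightarrow> real) \<Rightarrow> real) \<Rightarrow> (nat \<Rightarrow> 'a \<Rightarrow> real) \<Rightarrow> bool" where
  "E_Cauchy E f \<longleftrightarrow>
     (\<forall>\<epsilon>>0. \<exists>N. \<forall>n\<ge>N. \<forall>k\<ge>N. E (\<lambda>x. f n x - f k x) (\<lambda>x. f n x - f k x) < \<epsilon>)"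

definition sup_norm_closable :: "(('a \<Rightarrow> real) \<Rightarrow> ('a \<Rightarrow> real) \<Rightarrow> real) \<Rightarrow> ('a \<Rightarrow> real) set \<Rightarrow> bool" where
  "sup_norm_closable E D \<longleftrightarrow>
     (\<forall>f. (\<forall>n. f n \<in> D) \<and> E_Cauchy E f \<and> (\<lambda>n. sup_norm (f n)) \<longlonglongrightarrow> 0
        \<longrightarrow> (\<lambda>n. E (f n) (f n)) \<longlonglongrightarrow> 0)"

definition L_fun :: "(('a \<Rightarrow> real) \<Rightarrow> ('a \<Rightarrow> real) \<Rightarrow> real) \<Rightarrow> ('a \<Rightarrow> real) \<Rightarrow> ('a \<Rightarrow> real) \<Rightarrow> real" where
  "L_fun E f h = 2 * E (\<lambda>x. f x * h x) f - E (\<lambda>x. (f x)^2) h"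

definition S_sets :: "('a \<Rightarrow> real) set \<Rightarrow> 'a set set" where
  "S_sets D = {{x. f x > 0} | f. f \<in> D}"

inductive_set gen_algebra :: "'a set set \<Rightarrow> 'a set set" for S where
  gen_UNIV: "UNIV \<in> gen_algebra S"
| gen_base: "A \<in> S \<Longrightarrow> A \<in> gen_algebra S"
| gen_compl: "A \<in> gen_algebra S \<Longrightarrow> - A \<in> gen_algebra S"
| gen_union: "A \<in> gen_algebra S \<Longrightarrow> B \<in> gen_algebra S \<Longrightarrow> A \<union> B \<in> gen_algebra S"

definition sigma_D :: "('a \<Rightarrow> real) set \<Rightarrow> 'a set set" where
  "sigma_D D = sigma_sets UNIV {f -` B | f B. f \<in> D \<and> B \<in> sets borel}"

definition energy_S :: "(('a \<Rightarrow> real) \<Rightarrow> ('a \<Rightarrow> real) \<Rightarrow> real) \<Rightarrow> ('a \<Rightarrow> real) set \<Rightarrow> ('a \<Rightarrow> real) \<Rightarrow> 'a set \<Rightarrow> real" where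
  "energy_S E D f B = (SUP h\<in>{h\<in>D. \<forall>x. 0 \<le> h x \<and> h x \<le> indicator B x}. L_fun E f h)"

definition energy_measure :: "(('a \<Rightarrow> real) \<Rightarrow> ('a \<Rightarrow> real) \<Rightarrow> real) \<Rightarrow> ('a \<Rightarrow> real) set \<Rightarrow> ('a \<Rightarrow> real) \<Rightarrow> 'a set \<Rightarrow> real" where
  "energy_measure E D f A = (INF B\<in>{B\<in>S_sets D. A \<subseteq> B}. energy_S E D f B)"

definition energy_dominant :: "(('a \<Rightarrow> real) \<Rightarrow> ('a \<Rightarrow> real) \<Rightarrow> real) \<Rightarrow> ('a \<Rightarrow> real) set \<Rightarrow> 'a measure \<Rightarrow> bool" where
  "energy_dominant E D M \<longleftrightarrow>
     (\<forall>f\<in>D. \<forall>\<epsilon>>0. \<exists>\<delta>>0. \<forall>A\<in>gen_algebra (S_sets D).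
        measure M A < \<delta> \<longrightarrow> energy_measure E D f A < \<epsilon>)"

definition L2_closable :: "(('a \<Rightarrow> real) \<Rightarrow> ('a \<Rightarrow> real) \<Rightarrow> real) \<Rightarrow> ('a \<Rightarrow> real) set \<Rightarrow> 'a measure \<Rightarrow> bool" where
  "L2_closable E D M \<longleftrightarrow>
     (\<forall>f. (\<forall>n. f n \<in> D) \<and> E_Cauchy E f \<and> (\<lambda>n. \<integral>x. (f n x)^2 \<partial>M) \<longlonglongrightarrow> 0
        \<longrightarrow> (\<lambda>n. E (f n) (f n)) \<longlonglongrightarrow> 0)"

definition approx_seq :: "(('a \<Rightarrow> real) \<Rightarrow> ('a \<Rightarrow> real) \<Rightarrow> real) \<Rightarrow> ('a \<Rightarrow> real) set \<Rightarrow> 'a measure \<Rightarrow> (nat \<Rightarrow> 'a \<Rightarrow> real) \<Rightarrow> ('a \<Rightarrow> real) \<Rightarrow> bool" where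
  "approx_seq E D M f u \<longleftrightarrow>
     (\<forall>n. f n \<in> D) \<and> E_Cauchy E f \<and> (\<lambda>n. \<integral>x. (f n x - u x)^2 \<partial>M) \<longlonglongrightarrow> 0"

text \<open>The closure (F, Ebar) of (E, D) on L2(M) is a Dirichlet form: its domain F (the
 L2-limits of E-Cauchy sequences in D, with Ebar(u) = lim E(f_n)) is dense in L2(M),
 and normal contractions operate on it (Markov property). Bilinearity, symmetry,
 nonnegativity and closedness hold for the closure by construction.\<close>
definition closure_is_Dirichlet :: "(('a \<Rightarrow> real) \<Rightarrow> ('a \<Rightarrow> real) \<Rightarrow> real) \<Rightarrow> ('a \<Rightarrow> real) set \<Rightarrow> 'a measure \<Rightarrow> bool" where
  "closure_is_Dirichlet E D M \<longleftrightarrow>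
     (\<forall>u. u \<in> borel_measurable M \<and> integrable M (\<lambda>x. (u x)^2) \<longrightarrow>
        (\<exists>f. (\<forall>n. f n \<in> D) \<and> (\<lambda>n. \<integral>x. (f n x - u x)^2 \<partial>M) \<longlonglongrightarrow> 0)) \<and>
     (\<forall>u f F. u \<in> borel_measurable M \<and> integrable M (\<lambda>x. (u x)^2) \<and> approx_seq E D M f u
        \<and> normal_contraction F \<longrightarrow>
        (\<exists>g. approx_seq E D M g (F \<circ> u) \<and>
             lim (\<lambda>n. E (g n) (g n)) \<le> lim (\<lambda>n. E (f n) (f n))))"

definition has_carre_du_champ :: "(('a \<Rightarrow> real) \<Rightarrow> ('a \<Rightarrow> real) \<Rightarrow> real) \<Rightarrow> ('a \<Rightarrow> real) set \<Rightarrow> 'a measure \<Rightarrow> bool" where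
  "has_carre_du_champ E D M \<longleftrightarrow>
     (\<forall>f\<in>D. \<exists>\<nu> g. sets \<nu> = sets M \<and>
        (\<forall>A\<in>gen_algebra (S_sets D). emeasure \<nu> A = ennreal (energy_measure E D f A)) \<and>
        integrable M g \<and> (\<forall>x. g x \<ge> 0) \<and> \<nu> = density M (\<lambda>x. ennreal (g x)))"

end

theory Submission
  imports Defs
begin

text \<open>Approximating \<open>f\<close> by sawtooth functions \<open>\<sigma>\<close> of \<open>f\<close> with slopes \<open>\<plusminus>1\<close> and tiny amplitude removes
  the nonlocal energy and keeps the local one. With the elementary sign rules for \<open>E(u, v)\<close> on functions
  with separated supports, this yields, without any representation theory, \<open>L_f \<ge> 0\<close>, the bound
  \<open>L_f h \<le> 24 E(f)\<close> for \<open>0 \<le> h \<le> 1\<close>, and the estimate of \<open>E\<close> of the part of \<open>f\<close> above a level by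
  \<open>L_f h\<close> for any \<open>h\<close> equal to 1 where that part lives. Energy dominance turns \<open>L\<^sub>2\<close>-smallness of \<open>h\<close> into
  smallness of \<open>L_f h\<close>. Hence an \<open>L\<^sub>2\<close>-null, \<open>E\<close>-Cauchy sequence may be cut at small levels at a vanishing
  cost in energy, so that sup-norm closability applies; and \<open>L_f\<close> extends by \<open>L\<^sub>2\<close>-density of the
  domain to a measure that is absolutely continuous with respect to \<open>m\<close>.\<close>

section \<open>Bilinear forms on which normal contractions operate\<close>

text \<open>The functionals \<open>q\<close> below come from the pure jump form E(u) = 1/2 sum
  J(x,y) (u(x) - u(y))^2. There each of them is visibly nonnegative: 2 E(u) - L_u(h), for example,
  carries the weights 2 - h(x) - h(y) in place of 1, up to a factor. For an abstract
  \<open>E\<close> no such formula is at hand. Folding replaces it: q(r + s) - q(r - s) is four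
  times the polar form of \<open>q\<close> at (r, s), so only its sign on two layers matters,
  \<open>r\<close> below a level c and \<open>s\<close> above it, where r s = c s removes the
  products. This sign follows from the contraction property alone. What remains is to bound
  \<open>q\<close> from below along a uniformly null sequence of bounded energy, where crude norm
  estimates suffice. They cost constants: 24 would be 2 for a jump form. A second obstacle is that
  \<open>D\<close> need contain neither the constant 1 nor square roots. Hence the regularised root
  in the proof of positivity, the separate treatment of negative levels, and the repeated use of
  \<open>chi0\<close>.\<close>

locale contraction_form =
  fixes D :: "('a \<Rightarrow> real) set"
    and E :: "('a \<Rightarrow> real) \<Rightarrow> ('a \<Rightarrow> real) \<Rightarrow> real"
  assumes alg: "bounded_fun_algebra D"
    and form: "bilinear_form E D"
    and contr: "contractions_operate E D"
begin

section \<open>Algebra and lattice operations in the domain\<close>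

lemma D_zero [simp]: "(\<lambda>x. 0) \<in> D"
  using alg by (auto simp: bounded_fun_algebra_def)

lemma D_add [simp]: "f \<in> D \<Longrightarrow> g \<in> D \<Longrightarrow> (\<lambda>x. f x + g x) \<in> D"
  using alg by (auto simp: bounded_fun_algebra_def)

lemma D_scale [simp]: "f \<in> D \<Longrightarrow> (\<lambda>x. c * f x) \<in> D"
  using alg by (auto simp: bounded_fun_algebra_def)

lemma D_mult [simp]: "f \<in> D \<Longrightarrow> g \<in> D \<Longrightarrow> (\<lambda>x. f x * g x) \<in> D"
  using alg by (auto simp: bounded_fun_algebra_def)

lemma D_power2 [simp]: "f \<in> D \<Longrightarrow> (\<lambda>x. (f x)\<^sup>2) \<in> D"
  by (simp add: power2_eq_square)

lemma D_diff [simp]: "f \<in> D \<Longrightarrow> g \<in> D \<Longrightarrow> (\<lambda>x. f x - g x) \<in> D"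
  using D_add[OF _ D_scale[of g "-1"], of f] by simp

lemma D_uminus [simp]: "f \<in> D \<Longrightarrow> (\<lambda>x. - f x) \<in> D"
  using D_scale[of f "-1"] by simp

lemma D_divide [simp]: "f \<in> D \<Longrightarrow> (\<lambda>x. f x / c) \<in> D"
  using D_scale[of f "1/c"] by simp

lemma D_bounded:
  assumes "f \<in> D"
  obtains B where "B > 0" "\<And>x. \<bar>f x\<bar> \<le> B"
proof -
  from assms alg obtain B where B: "\<And>x. \<bar>f x\<bar> \<le> B"
    by (auto simp: bounded_fun_algebra_def bounded_fun_def)
  show ?thesis by (rule that[of "max B 1"]) (use B in \<open>auto intro: max.coboundedI1\<close>)
qed

lemma D_comp: "f \<in> D \<Longrightarrow> normal_contraction F \<Longrightarrow> (\<lambda>x. F (f x)) \<in> D"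
  using contr by (auto simp: contractions_operate_def comp_def)

lemma E_comp_le:
  "f \<in> D \<Longrightarrow> normal_contraction F \<Longrightarrow> E (\<lambda>x. F (f x)) (\<lambda>x. F (f x)) \<le> E f f"
  using contr by (auto simp: contractions_operate_def comp_def)

lemma D_abs [simp]: "f \<in> D \<Longrightarrow> (\<lambda>x. \<bar>f x\<bar>) \<in> D"
  by (rule D_comp) (auto simp: normal_contraction_def)

lemma D_max [simp]:
  assumes "f \<in> D" "g \<in> D" shows "(\<lambda>x. max (f x) (g x)) \<in> D"
proof -
  have "(\<lambda>x. (1/2) * (f x + g x + \<bar>f x - g x\<bar>)) \<in> D"
    using assms by simp
  also have "(\<lambda>x. (1/2) * (f x + g x + \<bar>f x - g x\<bar>)) = (\<lambda>x. max (f x) (g x))"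
    by (auto simp: max_def)
  finally show ?thesis .
qed

lemma D_min [simp]:
  assumes "f \<in> D" "g \<in> D" shows "(\<lambda>x. min (f x) (g x)) \<in> D"
proof -
  have "(\<lambda>x. f x + g x - max (f x) (g x)) \<in> D"
    using assms by simp
  also have "(\<lambda>x. f x + g x - max (f x) (g x)) = (\<lambda>x. min (f x) (g x))"
    by (auto simp: max_def min_def)
  finally show ?thesis .
qed

lemma D_min_const [simp]: "f \<in> D \<Longrightarrow> c \<ge> 0 \<Longrightarrow> (\<lambda>x. min (f x) c) \<in> D"
  by (rule D_comp[of f "\<lambda>t. min t c"]) (auto simp: normal_contraction_def)

lemma D_threshold [simp]: "f \<in> D \<Longrightarrow> c \<ge> 0 \<Longrightarrow> (\<lambda>x. max (f x - c) 0) \<in> D"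
  by (rule D_comp[of f "\<lambda>t. max (t - c) 0"]) (auto simp: normal_contraction_def)

section \<open>Bilinearity and the energy seminorm\<close>

lemma E_sym: "f \<in> D \<Longrightarrow> g \<in> D \<Longrightarrow> E f g = E g f"
  using form by (auto simp: bilinear_form_def)

lemma E_nonneg [simp]: "f \<in> D \<Longrightarrow> 0 \<le> E f f"
  using form by (auto simp: bilinear_form_def)

lemma E_add_left: "f \<in> D \<Longrightarrow> g \<in> D \<Longrightarrow> h \<in> D \<Longrightarrow> E (\<lambda>x. f x + g x) h = E f h + E g h"
  using form by (auto simp: bilinear_form_def)

lemma E_scale_left: "f \<in> D \<Longrightarrow> h \<in> D \<Longrightarrow> E (\<lambda>x. c * f x) h = c * E f h"
  using form by (auto simp: bilinear_form_def)

lemma E_diff_left: "f \<in> D \<Longrightarrow> g \<in> D \<Longrightarrow> h \<in> D \<Longrightarrow> E (\<lambda>x. f x - g x) h = E f h - E g h"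
  using E_add_left[OF _ D_scale[of g "-1"], of f h] E_scale_left[of g h "-1"] by simp

lemma E_add_right: "f \<in> D \<Longrightarrow> g \<in> D \<Longrightarrow> h \<in> D \<Longrightarrow> E h (\<lambda>x. f x + g x) = E h f + E h g"
  using E_add_left[of f g h] by (simp add: E_sym)

lemma E_scale_right: "f \<in> D \<Longrightarrow> h \<in> D \<Longrightarrow> E h (\<lambda>x. c * f x) = c * E h f"
  using E_scale_left[of f h c] by (simp add: E_sym)

lemma E_diff_right: "f \<in> D \<Longrightarrow> g \<in> D \<Longrightarrow> h \<in> D \<Longrightarrow> E h (\<lambda>x. f x - g x) = E h f - E h g"
  using E_diff_left[of f g h] by (simp add: E_sym)

lemmas E_bilinear = E_add_left E_add_right E_scale_left E_scale_right E_diff_left E_diff_right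

lemma E_zero_left [simp]: "g \<in> D \<Longrightarrow> E (\<lambda>x. 0) g = 0"
  using E_scale_left[of g g 0] by simp

definition nrm :: "('a \<Rightarrow> real) \<Rightarrow> real" where
  "nrm f = sqrt (E f f)"

lemma nrm_nonneg [simp]: "f \<in> D \<Longrightarrow> 0 \<le> nrm f"
  by (simp add: nrm_def)

lemma nrm_power2: "f \<in> D \<Longrightarrow> (nrm f)\<^sup>2 = E f f"
  by (simp add: nrm_def)

lemma nrm_mono: "E f f \<le> E g g \<Longrightarrow> nrm f \<le> nrm g"
  by (simp add: nrm_def)

lemma E_cauchy_schwarz:
  assumes f: "f \<in> D" and g: "g \<in> D"
  shows "\<bar>E f g\<bar> \<le> nrm f * nrm g"
proof -
  have q: "0 \<le> E f f + 2 * t * E f g + t\<^sup>2 * E g g" for t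
  proof -
    have "0 \<le> E (\<lambda>x. f x + t * g x) (\<lambda>x. f x + t * g x)" using f g by simp
    also have "\<dots> = E f f + 2 * t * E f g + t\<^sup>2 * E g g"
      using f g by (simp add: E_bilinear E_sym[of g f] power2_eq_square algebra_simps)
    finally show ?thesis .
  qed
  have "(E f g)\<^sup>2 \<le> E f f * E g g"
  proof (cases "E g g = 0")
    case True
    have "E f g = 0"
    proof (rule ccontr)
      assume nz: "E f g \<noteq> 0"
      \<comment> \<open>For E(g, g) = 0 the quadratic is affine in t, and this t would give it the
        value -1.\<close>
      have "0 \<le> E f f + 2 * (- (E f f + 1) / (2 * E f g)) * E f g"
        using q[of "- (E f f + 1) / (2 * E f g)"] True by simp
      thus False using nz by (simp add: field_simps)
    qed
    thus ?thesis using True by simp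
  next
    case False
    hence pos: "E g g > 0" using g E_nonneg[of g] by linarith
    have "0 \<le> E f f - (E f g)\<^sup>2 / E g g"
      using q[of "- E f g / E g g"] pos by (simp add: field_simps power2_eq_square)
    thus ?thesis using pos by (simp add: field_simps)
  qed
  hence "sqrt ((E f g)\<^sup>2) \<le> sqrt (E f f * E g g)" by (rule real_sqrt_le_mono)
  thus ?thesis by (simp add: nrm_def real_sqrt_mult)
qed

lemma nrm_add:
  assumes f: "f \<in> D" and g: "g \<in> D"
  shows "nrm (\<lambda>x. f x + g x) \<le> nrm f + nrm g"
proof (rule power2_le_imp_le)
  have "(nrm (\<lambda>x. f x + g x))\<^sup>2 = (nrm f)\<^sup>2 + 2 * E f g + (nrm g)\<^sup>2"
    using f g by (simp add: nrm_power2 E_bilinear E_sym[of g f])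
  also have "\<dots> \<le> (nrm f + nrm g)\<^sup>2"
    using E_cauchy_schwarz[OF f g] by (simp add: power2_sum)
  finally show "(nrm (\<lambda>x. f x + g x))\<^sup>2 \<le> (nrm f + nrm g)\<^sup>2" .
qed (use f g in simp)

lemma nrm_scale: "f \<in> D \<Longrightarrow> nrm (\<lambda>x. c * f x) = \<bar>c\<bar> * nrm f"
  by (simp add: nrm_def E_bilinear real_sqrt_mult flip: mult.assoc)

lemma nrm_diff: "f \<in> D \<Longrightarrow> g \<in> D \<Longrightarrow> nrm (\<lambda>x. f x - g x) \<le> nrm f + nrm g"
  using nrm_add[of f "\<lambda>x. (-1) * g x"] nrm_scale[of g "-1"] by simp

lemma E_diff_le:
  assumes "f \<in> D" "g \<in> D"
  shows "E (\<lambda>x. f x - g x) (\<lambda>x. f x - g x) \<le> 2 * (E f f + E g g)"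
proof -
  have "0 \<le> E (\<lambda>x. f x + g x) (\<lambda>x. f x + g x)" using assms by simp
  thus ?thesis using assms by (simp add: E_bilinear)
qed

section \<open>Norm bounds for squares and products\<close>

lemma nrm_square_le:
  assumes u: "u \<in> D" and C: "0 \<le> C" "\<And>x. \<bar>u x\<bar> \<le> C"
  shows "nrm (\<lambda>x. (u x)\<^sup>2) \<le> 2 * C * nrm u"
proof (cases "C = 0")
  case True
  hence "u = (\<lambda>x. 0)" using C by auto
  thus ?thesis using True by (simp add: nrm_def)
next
  case False
  hence C0: "C > 0" using C by simp
  \<comment> \<open>Truncating |t| at C makes t^2 / (2 C) a contraction on the whole line; on the
    range of \<open>u\<close> the truncation is invisible.\<close>
  define F where "F t = (min \<bar>t\<bar> C)\<^sup>2 / (2 * C)" for t :: real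
  have "\<bar>F s - F t\<bar> \<le> \<bar>s - t\<bar>" for s t
  proof -
    let ?a = "min \<bar>s\<bar> C" and ?b = "min \<bar>t\<bar> C"
    have "\<bar>F s - F t\<bar> = \<bar>?a - ?b\<bar> * (?a + ?b) / (2 * C)"
      using C0 by (simp add: F_def power2_eq_square flip: diff_divide_distrib)
        (simp add: square_diff_square_factored abs_mult)
    also have "\<dots> \<le> \<bar>?a - ?b\<bar> * (2 * C) / (2 * C)"
      using C0 by (intro divide_right_mono mult_left_mono) auto
    also have "\<dots> = \<bar>?a - ?b\<bar>" using C0 by simp
    also have "\<dots> \<le> \<bar>s - t\<bar>" by linarith
    finally show ?thesis .
  qed
  hence nc: "normal_contraction F" using C0 by (auto simp: normal_contraction_def F_def)
  have "(\<lambda>x. (u x)\<^sup>2) = (\<lambda>x. (2 * C) * F (u x))"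
    using C0 C(2) by (auto simp: F_def min_def)
  hence "nrm (\<lambda>x. (u x)\<^sup>2) = 2 * C * nrm (\<lambda>x. F (u x))"
    using C0 nrm_scale[OF D_comp[OF u nc], of "2 * C"] by simp
  also have "\<dots> \<le> 2 * C * nrm u"
    using C0 nrm_mono[OF E_comp_le[OF u nc]] by simp
  finally show ?thesis .
qed

text \<open>Polarisation reduces products to squares: f g = (a b / 4) (u^2 - v^2) with u, v = f/a
  \<plusminus> g/b, both bounded by 2. The point for later use is that the energy of each factor is
  weighted by the sup bound of the other, so that a uniformly small factor makes its term
  vanish.\<close>

lemma nrm_mult_le:
  assumes f: "f \<in> D" and g: "g \<in> D"
    and a: "a > 0" "\<And>x. \<bar>f x\<bar> \<le> a" and b: "b > 0" "\<And>x. \<bar>g x\<bar> \<le> b"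
  shows "nrm (\<lambda>x. f x * g x) \<le> 2 * (b * nrm f + a * nrm g)"
proof -
  define u where "u = (\<lambda>x. (1/a) * f x + (1/b) * g x)"
  define v where "v = (\<lambda>x. (1/a) * f x - (1/b) * g x)"
  have uv: "u \<in> D" "v \<in> D" using f g by (simp_all add: u_def v_def)
  have fa: "\<bar>(1/a) * f x\<bar> \<le> 1" and gb: "\<bar>(1/b) * g x\<bar> \<le> 1" for x
    using a b by (auto simp: abs_mult)
  have ub: "\<bar>u x\<bar> \<le> 2" and vb: "\<bar>v x\<bar> \<le> 2" for x
    using fa[of x] gb[of x] unfolding u_def v_def by linarith+
  have nf: "nrm (\<lambda>x. (1/a) * f x) = nrm f / a" "nrm (\<lambda>x. (1/b) * g x) = nrm g / b"
    using f g a b nrm_scale[of f "1/a"] nrm_scale[of g "1/b"] by simp_all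
  have n: "nrm u \<le> nrm f / a + nrm g / b" "nrm v \<le> nrm f / a + nrm g / b"
    using nrm_add[of "\<lambda>x. (1/a) * f x" "\<lambda>x. (1/b) * g x"]
      nrm_diff[of "\<lambda>x. (1/a) * f x" "\<lambda>x. (1/b) * g x"] f g nf D_scale[of f "1/a"] D_scale[of g "1/b"]
    unfolding u_def v_def by metis+
  have "(\<lambda>x. f x * g x) = (\<lambda>x. (a * b / 4) * ((u x)\<^sup>2 - (v x)\<^sup>2))"
    using a b by (auto simp: u_def v_def power2_eq_square field_simps)
  hence "nrm (\<lambda>x. f x * g x) = a * b / 4 * nrm (\<lambda>x. (u x)\<^sup>2 - (v x)\<^sup>2)"
    using a b uv nrm_scale[of "\<lambda>x. (u x)\<^sup>2 - (v x)\<^sup>2" "a * b / 4"] by simp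
  also have "\<dots> \<le> a * b / 4 * (2 * 2 * nrm u + 2 * 2 * nrm v)"
    using a b nrm_diff[of "\<lambda>x. (u x)\<^sup>2" "\<lambda>x. (v x)\<^sup>2"] uv
      nrm_square_le[OF uv(1) _ ub] nrm_square_le[OF uv(2) _ vb]
    by (intro mult_left_mono) auto
  also have "\<dots> \<le> a * b / 4 * (8 * (nrm f / a + nrm g / b))"
    using a b n by (intro mult_left_mono) auto
  also have "\<dots> = 2 * (b * nrm f + a * nrm g)"
    using a b by (simp add: field_simps)
  finally show ?thesis .
qed

section \<open>Sign rules for functions with separated supports, and folding\<close>

lemma E_unit_nonneg:
  assumes u: "u \<in> D" and v: "v \<in> D" and c: "c \<ge> 0" "\<And>x. u x \<le> c"
    and v0: "\<And>x. v x \<ge> 0" and uv: "\<And>x. v x > 0 \<Longrightarrow> u x = c"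
  shows "E u v \<ge> 0"
proof (rule ccontr)
  assume neg: "\<not> E u v \<ge> 0"
  \<comment> \<open>Adding t v raises \<open>u\<close> only where it already has the value c, and
    the contraction min(., c) cuts the addition off again. So E(u) \<le> E(u + t v), and for small t
    the linear term 2 t E(u, v) decides.\<close>
  have *: "0 \<le> 2 * E u v + t * E v v" if t: "t > 0" for t
  proof -
    have "min (u x + t * v x) c = u x" for x
      using c(2)[of x] v0[of x] uv[of x] t by (cases "v x = 0") auto
    moreover have "E (\<lambda>x. min (u x + t * v x) c) (\<lambda>x. min (u x + t * v x) c)
        \<le> E (\<lambda>x. u x + t * v x) (\<lambda>x. u x + t * v x)"
      using u v c by (intro E_comp_le[where F="\<lambda>s. min s c"]) (auto simp: normal_contraction_def)
    ultimately have "E u u \<le> E (\<lambda>x. u x + t * v x) (\<lambda>x. u x + t * v x)" by simp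
    hence "0 \<le> t * (2 * E u v + t * E v v)"
      using u v by (simp add: E_bilinear E_sym[of v u] algebra_simps)
    thus ?thesis using t by (simp add: zero_le_mult_iff)
  qed
  have vv: "E v v \<ge> 0" using v by simp
  define t where "t = - E u v / (E v v + 1)"
  have "t > 0" using neg vv by (simp add: t_def divide_neg_pos)
  moreover have "t * (E v v + 1) = - E u v" using vv by (simp add: t_def)
  ultimately show False using *[of t] neg by (simp add: algebra_simps)
qed

lemma E_disjoint_nonpos:
  assumes "u \<in> D" "v \<in> D" "\<And>x. u x \<ge> 0" "\<And>x. v x \<ge> 0" "\<And>x. u x * v x = 0"
  shows "E u v \<le> 0"
proof -
  \<comment> \<open>The function -u is bounded by 0 and has this value wherever v > 0: the previous
    rule at level 0.\<close>
  have "E (\<lambda>x. (-1) * u x) v \<ge> 0"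
    using assms by (intro E_unit_nonneg[of _ _ 0]) (auto, force)
  thus ?thesis using assms by (simp add: E_scale_left[of u v "-1", simplified])
qed

text \<open>Folding \<open>p\<close> at height \<open>C/2\<close> halves its range; iterating gives sawtooth functions of \<open>p\<close> that
  tend to zero uniformly while keeping the local part of the energy of \<open>p\<close>. A quadratic form
  that is nonnegative on the pair (lower half, upper half) decreases along the iteration.\<close>

lemma fold_sequence:
  fixes q :: "('a \<Rightarrow> real) \<Rightarrow> real"
  assumes p: "p \<in> D" and C: "C > 0" "\<And>x. 0 \<le> p x" "\<And>x. p x \<le> C"
    and q: "\<And>r s c. r \<in> D \<Longrightarrow> s \<in> D \<Longrightarrow> c > 0 \<Longrightarrow> (\<And>x. 0 \<le> r x) \<Longrightarrow> (\<And>x. r x \<le> c) \<Longrightarrow>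
      (\<And>x. 0 \<le> s x) \<Longrightarrow> (\<And>x. s x > 0 \<Longrightarrow> r x = c) \<Longrightarrow> (\<And>x. p x = 0 \<Longrightarrow> r x = 0) \<Longrightarrow>
      q (\<lambda>x. r x - s x) \<le> q (\<lambda>x. r x + s x)"
  obtains \<sigma> where "\<And>k::nat. \<sigma> k \<in> D" "\<And>k x. 0 \<le> \<sigma> k x" "\<And>k x. \<sigma> k x \<le> C / 2 ^ k"
    "\<And>k. nrm (\<sigma> k) \<le> nrm p" "\<And>k. q (\<sigma> k) \<le> q p"
proof -
  \<comment> \<open>The zero set of \<open>p\<close> is carried along because the sign of
    \<open>q\<close> on layers may depend on it, as it does in the threshold estimate.\<close>
  have "\<exists>\<sigma>. \<sigma> \<in> D \<and> (\<forall>x. 0 \<le> \<sigma> x \<and> \<sigma> x \<le> C / 2 ^ k \<and> (p x = 0 \<longrightarrow> \<sigma> x = 0)) \<and>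
      nrm \<sigma> \<le> nrm p \<and> q \<sigma> \<le> q p" for k :: nat
  proof (induction k)
    case 0
    show ?case using p C by (intro exI[of _ p]) auto
  next
    case (Suc k)
    then obtain \<sigma> where s: "\<sigma> \<in> D" "\<And>x. 0 \<le> \<sigma> x" "\<And>x. \<sigma> x \<le> C / 2 ^ k"
      "\<And>x. p x = 0 \<Longrightarrow> \<sigma> x = 0" "nrm \<sigma> \<le> nrm p" "q \<sigma> \<le> q p" by blast
    define c where "c = C / 2 ^ Suc k"
    have c: "c > 0" "C / 2 ^ k = 2 * c" using C by (auto simp: c_def)
    define r where "r = (\<lambda>x. min (\<sigma> x) c)"
    define t where "t = (\<lambda>x. max (\<sigma> x - c) 0)"
    have rt: "r \<in> D" "t \<in> D" using s c by (auto simp: r_def t_def)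
    \<comment> \<open>r - t is \<sigma> reflected downwards at height c, while r + t is \<sigma>
      itself.\<close>
    have "q (\<lambda>x. r x - t x) \<le> q (\<lambda>x. r x + t x)"
      using rt s c by (intro q[of r t c]) (auto simp: r_def t_def)
    moreover have "(\<lambda>x. r x + t x) = \<sigma>" by (auto simp: r_def t_def)
    ultimately have 1: "q (\<lambda>x. r x - t x) \<le> q p" using s by simp
    have "(\<lambda>x. r x - t x) = (\<lambda>x. (\<lambda>y. min y c - max (y - c) 0) (\<sigma> x))"
      by (auto simp: r_def t_def)
    moreover have "normal_contraction (\<lambda>y. min y c - max (y - c) 0)"
      using c by (auto simp: normal_contraction_def)
    ultimately have 2: "nrm (\<lambda>x. r x - t x) \<le> nrm \<sigma>"
      using nrm_mono[OF E_comp_le[OF s(1), of "\<lambda>y. min y c - max (y - c) 0"]] by simp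
    have 3: "0 \<le> r x - t x \<and> r x - t x \<le> c \<and> (p x = 0 \<longrightarrow> r x - t x = 0)" for x
      using s(2,3)[of x] s(4)[of x] c by (auto simp: r_def t_def)
    show ?case
      using 1 2 3 rt s(5) by (intro exI[of _ "\<lambda>x. r x - t x"]) (auto simp: c_def)
  qed
  then obtain \<sigma> where "\<And>k. \<sigma> k \<in> D \<and> (\<forall>x. 0 \<le> \<sigma> k x \<and> \<sigma> k x \<le> C / 2 ^ k \<and> (p x = 0 \<longrightarrow> \<sigma> k x = 0)) \<and>
      nrm (\<sigma> k) \<le> nrm p \<and> q (\<sigma> k) \<le> q p" by metis
  thus ?thesis using that by blast
qed

section \<open>Positivity and bounds for the energy functionals\<close>


lemma D_upper_bound:
  assumes "f \<in> D" shows "\<exists>B>0. \<forall>x. f x \<le> B"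
  using D_bounded[OF assms] abs_le_D1 by metis

lemma halving_tendsto_0: "(\<lambda>k. C / 2 ^ k) \<longlonglongrightarrow> (0::real)"
  using tendsto_mult[OF tendsto_const[of C] LIMSEQ_realpow_zero[of "1/2"]]
  by (simp add: power_divide)

text \<open>For a jump form, E(\<sigma> w^2, \<sigma>) - E(\<sigma> w) = -1/2 sum J(x,y) \<sigma>(x)
  \<sigma>(y) (w(x) - w(y))^2, which is at least -\<eta>^2 E(w). So for a square weight the loss
  involves the size of \<sigma> and the energy of \<open>w\<close>, but not the energy of \<sigma>.
  This is what is needed when \<sigma> is folded to 0 while its energy merely stays bounded.\<close>

lemma E_small_square_weight:
  assumes \<sigma>: "\<sigma> \<in> D" and \<eta>: "\<eta> > 0" "\<And>x. 0 \<le> \<sigma> x" "\<And>x. \<sigma> x \<le> \<eta>"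
    and w: "w \<in> D" "\<And>x. 0 \<le> w x"
  shows "E (\<lambda>x. \<sigma> x * (w x)\<^sup>2) \<sigma> \<ge> - 5 * \<eta>\<^sup>2 * E w w"
proof -
  define q where "q u = \<eta>\<^sup>2 * E u u - E (\<lambda>x. \<sigma> x * u x) (\<lambda>x. \<sigma> x * u x)
      + E (\<lambda>x. \<sigma> x * (u x)\<^sup>2) \<sigma>" for u
  obtain C where C: "C > 0" "\<And>x. w x \<le> C"
    using D_upper_bound[OF w(1)] by blast
  have q: "q (\<lambda>x. r x - s x) \<le> q (\<lambda>x. r x + s x)"
    if r: "r \<in> D" and s: "s \<in> D" and c: "c > 0" and r0: "\<And>x. 0 \<le> r x" and rc: "\<And>x. r x \<le> c"
      and s0: "\<And>x. 0 \<le> s x" and rs: "\<And>x. s x > 0 \<Longrightarrow> r x = c" for r s c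
  proof -
    have rs': "r x * s x = c * s x" for x using s0[of x] rs[of x] by (cases "s x = 0") auto
    \<comment> \<open>A quarter of q(r + s) - q(r - s) is \<eta>^2 E(r, s) + E(u, v). As u =
      \<sigma> (c - r) and v = \<sigma> s have disjoint supports, E(u, v) is nonpositive and must be
      compensated: \<eta> r + u stays below \<eta> c and reaches it where s > 0, and \<eta> s - v
      \<ge> 0 lives where r = c.\<close>
    define v where "v = (\<lambda>x. \<sigma> x * s x)"
    define u where "u = (\<lambda>x. c * \<sigma> x - \<sigma> x * r x)"
    have uv: "u \<in> D" "v \<in> D" using r s \<sigma> by (auto simp: u_def v_def)
    have ueq: "u x = \<sigma> x * (c - r x)" for x by (simp add: u_def algebra_simps)
    have 1: "0 \<le> E (\<lambda>x. \<eta> * r x + u x) v"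
    proof (rule E_unit_nonneg[of _ _ "\<eta> * c"])
      fix x
      have "\<eta> * r x + u x \<le> \<eta> * r x + \<eta> * (c - r x)"
        unfolding ueq using \<eta>(3)[of x] rc[of x] by (intro add_left_mono mult_right_mono) auto
      thus "\<eta> * r x + u x \<le> \<eta> * c" by (simp add: algebra_simps)
      show "0 \<le> v x" using \<eta> s0 by (simp add: v_def)
      assume "v x > 0"
      hence "s x > 0" using \<eta>(2)[of x] s0[of x] by (auto simp: v_def zero_less_mult_iff)
      thus "\<eta> * r x + u x = \<eta> * c" using rs by (simp add: ueq)
    qed (use uv r \<eta> c in auto)
    have 2: "0 \<le> E r (\<lambda>x. \<eta> * s x - v x)"
    proof (rule E_unit_nonneg[of _ _ c])
      fix x
      show "0 \<le> \<eta> * s x - v x" using mult_right_mono[OF \<eta>(3) s0] by (simp add: v_def)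
      assume "0 < \<eta> * s x - v x"
      hence "s x \<noteq> 0" by (auto simp: v_def)
      thus "r x = c" using rs s0[of x] by force
    qed (use uv r s rc c in auto)
    have X: "0 \<le> \<eta>\<^sup>2 * E r s + E u v"
    proof -
      have "E r v \<le> \<eta> * E r s" using 2 r s uv by (simp add: E_bilinear)
      hence "\<eta> * E r v \<le> \<eta> * (\<eta> * E r s)" using \<eta> by (intro mult_left_mono) auto
      thus ?thesis using 1 r uv by (simp add: E_bilinear power2_eq_square)
    qed
    have Euv: "E u v = c * E (\<lambda>x. \<sigma> x * s x) \<sigma> - E (\<lambda>x. \<sigma> x * r x) (\<lambda>x. \<sigma> x * s x)"
      using \<sigma> r s by (simp add: u_def v_def E_bilinear E_sym[of \<sigma>])
    have e1: "(\<lambda>x. \<sigma> x * (r x + s x)) = (\<lambda>x. \<sigma> x * r x + \<sigma> x * s x)"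
      "(\<lambda>x. \<sigma> x * (r x - s x)) = (\<lambda>x. \<sigma> x * r x - \<sigma> x * s x)"
      by (auto simp: algebra_simps)
    have sq: "(r x + s x)\<^sup>2 = (r x)\<^sup>2 + 2 * (c * s x) + (s x)\<^sup>2"
      "(r x - s x)\<^sup>2 = (r x)\<^sup>2 - 2 * (c * s x) + (s x)\<^sup>2" for x
      using rs'[of x] by (auto simp: power2_eq_square algebra_simps)
    have e2: "(\<lambda>x. \<sigma> x * (r x + s x)\<^sup>2) = (\<lambda>x. \<sigma> x * (r x)\<^sup>2 + 2 * c * (\<sigma> x * s x) + \<sigma> x * (s x)\<^sup>2)"
      "(\<lambda>x. \<sigma> x * (r x - s x)\<^sup>2) = (\<lambda>x. \<sigma> x * (r x)\<^sup>2 - 2 * c * (\<sigma> x * s x) + \<sigma> x * (s x)\<^sup>2)"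
      unfolding sq by (simp_all add: algebra_simps)
    have "q (\<lambda>x. r x + s x) - q (\<lambda>x. r x - s x) = 4 * (\<eta>\<^sup>2 * E r s + E u v)"
      using r s \<sigma> E_sym[OF s r] E_sym[of "\<lambda>x. \<sigma> x * s x" "\<lambda>x. \<sigma> x * r x"]
      unfolding q_def e1 e2 Euv by (simp add: E_bilinear) (simp add: algebra_simps)
    thus ?thesis using X by simp
  qed
  obtain \<tau> where \<tau>: "\<And>k::nat. \<tau> k \<in> D" "\<And>k x. 0 \<le> \<tau> k x" "\<And>k x. \<tau> k x \<le> C / 2 ^ k"
    "\<And>k. nrm (\<tau> k) \<le> nrm w" "\<And>k. q (\<tau> k) \<le> q w"
    by (rule fold_sequence[OF w(1) C(1) w(2) C(2), of q]) (use q in blast)+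
  have lower: "- ((2 * (C / 2 ^ k * nrm \<sigma> + \<eta> * nrm w))\<^sup>2)
      - 2 * ((C / 2 ^ k)\<^sup>2 * nrm \<sigma> + \<eta> * (2 * (C / 2 ^ k) * nrm w)) * nrm \<sigma> \<le> q w" for k
  proof -
    define e where "e = C / 2 ^ k"
    have e: "e > 0" using C by (simp add: e_def)
    have b: "\<bar>\<sigma> x\<bar> \<le> \<eta>" "\<bar>\<tau> k x\<bar> \<le> e" for x using \<eta> \<tau> by (auto simp: e_def)
    have b2: "\<bar>(\<tau> k x)\<^sup>2\<bar> \<le> e\<^sup>2" for x using power_mono[OF b(2)[of x], of 2] by simp
    have "nrm (\<lambda>x. \<sigma> x * \<tau> k x) \<le> 2 * (e * nrm \<sigma> + \<eta> * nrm (\<tau> k))"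
      by (rule nrm_mult_le) (use \<sigma> \<tau> \<eta> e b in auto)
    also have "\<dots> \<le> 2 * (e * nrm \<sigma> + \<eta> * nrm w)" using \<tau>(4)[of k] \<eta> by simp
    finally have "(nrm (\<lambda>x. \<sigma> x * \<tau> k x))\<^sup>2 \<le> (2 * (e * nrm \<sigma> + \<eta> * nrm w))\<^sup>2"
      using \<sigma> \<tau> by (intro power_mono) auto
    hence 1: "E (\<lambda>x. \<sigma> x * \<tau> k x) (\<lambda>x. \<sigma> x * \<tau> k x) \<le> (2 * (e * nrm \<sigma> + \<eta> * nrm w))\<^sup>2"
      using \<sigma> \<tau> by (simp add: nrm_power2)
    have t2: "nrm (\<lambda>x. (\<tau> k x)\<^sup>2) \<le> 2 * e * nrm w"
      using nrm_square_le[OF \<tau>(1)[of k] less_imp_le[OF e] b(2)] mult_left_mono[OF \<tau>(4)[of k], of "2 * e"] e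
      by linarith
    have "nrm (\<lambda>x. \<sigma> x * (\<tau> k x)\<^sup>2) \<le> 2 * (e\<^sup>2 * nrm \<sigma> + \<eta> * nrm (\<lambda>x. (\<tau> k x)\<^sup>2))"
      by (rule nrm_mult_le) (use \<sigma> \<tau> \<eta> e b b2 in auto)
    also have "\<dots> \<le> 2 * (e\<^sup>2 * nrm \<sigma> + \<eta> * (2 * e * nrm w))"
      using mult_left_mono[OF t2, of \<eta>] \<eta> by simp
    finally have "nrm (\<lambda>x. \<sigma> x * (\<tau> k x)\<^sup>2) * nrm \<sigma> \<le> 2 * (e\<^sup>2 * nrm \<sigma> + \<eta> * (2 * e * nrm w)) * nrm \<sigma>"
      using \<sigma> by (intro mult_right_mono) auto
    moreover have "\<bar>E (\<lambda>x. \<sigma> x * (\<tau> k x)\<^sup>2) \<sigma>\<bar> \<le> nrm (\<lambda>x. \<sigma> x * (\<tau> k x)\<^sup>2) * nrm \<sigma>"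
      using \<sigma> \<tau> by (intro E_cauchy_schwarz) auto
    ultimately have 2: "- (2 * (e\<^sup>2 * nrm \<sigma> + \<eta> * (2 * e * nrm w)) * nrm \<sigma>) \<le> E (\<lambda>x. \<sigma> x * (\<tau> k x)\<^sup>2) \<sigma>"
      by linarith
    have "0 \<le> \<eta>\<^sup>2 * E (\<tau> k) (\<tau> k)" using \<tau> by simp
    thus ?thesis using 1 2 \<tau>(5)[of k] unfolding q_def[of "\<tau> k"] e_def by linarith
  qed
  \<comment> \<open>Only E(\<sigma> \<tau>_k) survives in the limit, bounded by (2 \<eta> nrm w)^2 =
    4 \<eta>^2 E(w). Together with the term \<eta>^2 E(w) of \<open>q w\<close> this gives the
    constant 5.\<close>
  have "(\<lambda>k. - ((2 * (C / 2 ^ k * nrm \<sigma> + \<eta> * nrm w))\<^sup>2)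
      - 2 * ((C / 2 ^ k)\<^sup>2 * nrm \<sigma> + \<eta> * (2 * (C / 2 ^ k) * nrm w)) * nrm \<sigma>)
      \<longlonglongrightarrow> - ((2 * (0 * nrm \<sigma> + \<eta> * nrm w))\<^sup>2) - 2 * (0\<^sup>2 * nrm \<sigma> + \<eta> * (2 * 0 * nrm w)) * nrm \<sigma>"
    by (intro tendsto_intros halving_tendsto_0)
  from LIMSEQ_le_const2[OF this] lower
  have "- ((2 * (\<eta> * nrm w))\<^sup>2) \<le> q w" by force
  moreover have "(2 * (\<eta> * nrm w))\<^sup>2 = 4 * \<eta>\<^sup>2 * E w w"
    using w by (simp add: power_mult_distrib nrm_power2)
  moreover have "0 \<le> E (\<lambda>x. \<sigma> x * w x) (\<lambda>x. \<sigma> x * w x)" using \<sigma> w by simp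
  ultimately show ?thesis unfolding q_def by linarith
qed

section \<open>The polar form of the energy functionals\<close>

definition L_pair :: "('a \<Rightarrow> real) \<Rightarrow> ('a \<Rightarrow> real) \<Rightarrow> ('a \<Rightarrow> real) \<Rightarrow> real" where
  "L_pair f g h = E (\<lambda>x. f x * h x) g + E (\<lambda>x. g x * h x) f - E (\<lambda>x. f x * g x) h"

lemma L_fun_eq_L_pair: "L_fun E f h = L_pair f f h"
  by (simp add: L_fun_def L_pair_def power2_eq_square)

lemma L_pair_sym: "L_pair f g h = L_pair g f h"
  by (simp add: L_pair_def mult.commute)

lemma L_pair_add_left:
  assumes "f \<in> D" "f' \<in> D" "g \<in> D" "h \<in> D"
  shows "L_pair (\<lambda>x. f x + f' x) g h = L_pair f g h + L_pair f' g h"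
  using assms by (simp add: L_pair_def E_bilinear distrib_right)

lemma L_pair_diff_left:
  assumes "f \<in> D" "f' \<in> D" "g \<in> D" "h \<in> D"
  shows "L_pair (\<lambda>x. f x - f' x) g h = L_pair f g h - L_pair f' g h"
  using assms by (simp add: L_pair_def E_bilinear left_diff_distrib)

lemma L_fun_add:
  assumes "f \<in> D" "g \<in> D" "h \<in> D"
  shows "L_fun E (\<lambda>x. f x + g x) h = L_fun E f h + 2 * L_pair f g h + L_fun E g h"
proof -
  let ?s = "\<lambda>x. f x + g x"
  have "L_pair ?s ?s h = L_pair f ?s h + L_pair g ?s h" using assms by (simp add: L_pair_add_left)
  also have "\<dots> = L_pair ?s f h + L_pair ?s g h" by (metis L_pair_sym)
  finally show ?thesis using assms L_pair_sym[of g f h] by (simp add: L_fun_eq_L_pair L_pair_add_left)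
qed

lemma L_fun_diff:
  assumes "f \<in> D" "g \<in> D" "h \<in> D"
  shows "L_fun E (\<lambda>x. f x - g x) h = L_fun E f h - 2 * L_pair f g h + L_fun E g h"
proof -
  let ?s = "\<lambda>x. f x - g x"
  have "L_pair ?s ?s h = L_pair f ?s h - L_pair g ?s h" using assms by (simp add: L_pair_diff_left)
  also have "\<dots> = L_pair ?s f h - L_pair ?s g h" by (metis L_pair_sym)
  finally show ?thesis using assms L_pair_sym[of g f h] by (simp add: L_fun_eq_L_pair L_pair_diff_left)
qed

lemma L_fun_plus_arg:
  assumes "f \<in> D" "g \<in> D" "h \<in> D"
  shows "L_fun E f (\<lambda>x. g x + h x) = L_fun E f g + L_fun E f h"
  using assms by (simp add: L_fun_def E_bilinear distrib_left)

lemma L_fun_scale_arg: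
  assumes "f \<in> D" "h \<in> D"
  shows "L_fun E f (\<lambda>x. c * h x) = c * L_fun E f h"
proof -
  have "(\<lambda>x. f x * (c * h x)) = (\<lambda>x. c * (f x * h x))" by (simp add: mult_ac)
  thus ?thesis using assms by (simp add: L_fun_def E_bilinear algebra_simps)
qed

lemma L_fun_diff_arg:
  assumes "f \<in> D" "g \<in> D" "h \<in> D"
  shows "L_fun E f (\<lambda>x. g x - h x) = L_fun E f g - L_fun E f h"
  using assms by (simp add: L_fun_def E_bilinear right_diff_distrib)

text \<open>Since r s = c s, the term E(r s, h) merges with E(r h, s), and the polar form becomes
  E(r, s h) - E((c - r) h, s). The first term falls under the unit rule, the second has disjoint
  supports. This is the sign that makes L_u(h) decrease when \<open>u\<close> is folded.\<close>

lemma L_pair_layers_nonneg: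
  assumes r: "r \<in> D" and s: "s \<in> D" and h: "h \<in> D" "\<And>x. 0 \<le> h x" and c: "c > 0"
    and r0: "\<And>x. 0 \<le> r x" and rc: "\<And>x. r x \<le> c"
    and s0: "\<And>x. 0 \<le> s x" and rs: "\<And>x. s x > 0 \<Longrightarrow> r x = c"
  shows "0 \<le> L_pair r s h"
proof -
  have rs': "r x * s x = c * s x" for x using s0[of x] rs[of x] by (cases "s x = 0") auto
  have "0 \<le> E r (\<lambda>x. s x * h x)"
  proof (rule E_unit_nonneg[of _ _ c])
    fix x assume "0 < s x * h x"
    hence "s x > 0" using s0[of x] by (auto simp: zero_less_mult_iff)
    thus "r x = c" by (rule rs)
  qed (use r s h c rc s0 in auto)
  moreover have "E (\<lambda>x. c * h x - r x * h x) s \<le> 0"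
  proof (rule E_disjoint_nonpos)
    fix x show "0 \<le> c * h x - r x * h x"
      using mult_right_mono[OF rc h(2)] by simp
    have "(c * h x - r x * h x) * s x = h x * (c * s x - r x * s x)" by (simp add: algebra_simps)
    thus "(c * h x - r x * h x) * s x = 0" by (simp add: rs')
  qed (use r s h s0 in auto)
  moreover have "L_pair r s h = E r (\<lambda>x. s x * h x) - E (\<lambda>x. c * h x - r x * h x) s"
    unfolding L_pair_def rs' using r s h by (simp add: E_bilinear E_sym[of s h] E_sym[of "\<lambda>x. s x * h x" r])
  ultimately show ?thesis by simp
qed

text \<open>Folding decreases L_u(h), so a lower bound along the folded functions is enough. There
  E(\<sigma>_k^2, h) vanishes in the limit, but norm bounds do not control the sign of E(\<sigma>_k
  h, \<sigma>_k), as the energy of \<sigma>_k need not vanish. The square-weight estimate does, once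
  h is written as a square up to a small error.\<close>

lemma L_fun_nonneg_of_nonneg:
  assumes f: "f \<in> D" "\<And>x. 0 \<le> f x" and h: "h \<in> D" "\<And>x. 0 \<le> h x"
  shows "0 \<le> L_fun E f h"
proof -
  obtain C where C: "C > 0" "\<And>x. f x \<le> C" using D_upper_bound[OF f(1)] by blast
  obtain H where H: "H > 0" "\<And>x. h x \<le> H" using D_upper_bound[OF h(1)] by blast
  define q where "q u = L_fun E u h" for u
  have q: "q (\<lambda>x. r x - s x) \<le> q (\<lambda>x. r x + s x)"
    if "r \<in> D" "s \<in> D" "c > 0" "\<And>x. 0 \<le> r x" "\<And>x. r x \<le> c" "\<And>x. 0 \<le> s x" "\<And>x. s x > 0 \<Longrightarrow> r x = c"
    for r s c
    using L_pair_layers_nonneg[of r s h c] that h by (simp add: q_def L_fun_add L_fun_diff)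
  obtain \<sigma> where \<sigma>: "\<And>k::nat. \<sigma> k \<in> D" "\<And>k x. 0 \<le> \<sigma> k x" "\<And>k x. \<sigma> k x \<le> C / 2 ^ k"
    "\<And>k. nrm (\<sigma> k) \<le> nrm f" "\<And>k. q (\<sigma> k) \<le> q f"
    by (rule fold_sequence[OF f(1) C(1) f(2) C(2), of q]) (use q in blast)+
  have main: "- (8 * e * sqrt H * E f f) \<le> L_fun E f h" if e: "e > 0" for e
  proof -
    \<comment> \<open>The root of h is not a Lipschitz function of h and may lie outside
      \<open>D\<close>. The regularised root w = sqrt(h + e^2) - e lies in \<open>D\<close>, and h =
      w^2 + 2 e w exactly; the surplus costs a multiple of e. The limit in k has to precede e
      \<rightarrow> 0, since E(w) may blow up.\<close>
    define G where "G t = 2 * e * (sqrt (\<bar>t\<bar> + e\<^sup>2) - e)" for t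
    have "\<bar>G s - G t\<bar> \<le> \<bar>s - t\<bar>" for s t
    proof -
      let ?a = "sqrt (\<bar>s\<bar> + e\<^sup>2)" and ?b = "sqrt (\<bar>t\<bar> + e\<^sup>2)"
      have ab: "?a \<ge> e" "?b \<ge> e" using e by (auto intro!: real_le_rsqrt)
      have "\<bar>?a - ?b\<bar> * (2 * e) \<le> \<bar>?a - ?b\<bar> * (?a + ?b)"
        using ab by (intro mult_left_mono) auto
      also have "\<dots> = \<bar>?a\<^sup>2 - ?b\<^sup>2\<bar>"
      proof -
        have "?a\<^sup>2 - ?b\<^sup>2 = (?a - ?b) * (?a + ?b)" by (simp only: power2_eq_square square_diff_square_factored mult.commute)
        thus ?thesis using ab e by (simp only: abs_mult) simp
      qed
      also have "\<dots> = \<bar>\<bar>s\<bar> - \<bar>t\<bar>\<bar>" by simp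
      also have "\<dots> \<le> \<bar>s - t\<bar>" by linarith
      finally have "\<bar>?a - ?b\<bar> * (2 * e) \<le> \<bar>s - t\<bar>" .
      moreover have "G s - G t = (?a - ?b) * (2 * e)" by (simp add: G_def algebra_simps)
      ultimately show ?thesis using e by (simp add: abs_mult)
    qed
    hence nc: "normal_contraction G" using e by (simp add: normal_contraction_def G_def)
    define w where "w = (\<lambda>x. sqrt (h x + e\<^sup>2) - e)"
    have "w = (\<lambda>x. (1 / (2 * e)) * G (h x))"
      using e h by (auto simp: w_def G_def)
    hence w: "w \<in> D" using D_scale[OF D_comp[OF h(1) nc], of "1 / (2 * e)"] by simp
    have w0: "0 \<le> w x" for x using h(2)[of x] e by (simp add: w_def real_le_rsqrt)
    have hw: "h x = (w x)\<^sup>2 + 2 * e * w x" for x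
    proof -
      define S where "S = sqrt (h x + e\<^sup>2)"
      have "S\<^sup>2 = h x + e\<^sup>2" using h(2)[of x] by (simp add: S_def)
      moreover have "w x = S - e" by (simp add: w_def S_def)
      moreover have "(S - e)\<^sup>2 + 2 * e * (S - e) = S\<^sup>2 - e\<^sup>2"
        by (simp add: power2_eq_square algebra_simps)
      ultimately show ?thesis by simp
    qed
    have wH: "w x \<le> sqrt H" for x
    proof (rule real_le_rsqrt)
      have "0 \<le> 2 * e * w x" using e w0 by simp
      thus "(w x)\<^sup>2 \<le> H" using hw[of x] H(2)[of x] by linarith
    qed
    have low: "- 10 * (C / 2 ^ k)\<^sup>2 * E w w - 8 * e * (sqrt H * nrm f + C / 2 ^ k * nrm w) * nrm f
      - 2 * (C / 2 ^ k) * nrm f * nrm h \<le> L_fun E f h" for k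
    proof -
      define \<eta> where "\<eta> = C / 2 ^ k"
      have \<eta>: "\<eta> > 0" using C by (simp add: \<eta>_def)
      have b: "\<bar>\<sigma> k x\<bar> \<le> \<eta>" "\<bar>w x\<bar> \<le> sqrt H" for x using \<sigma> wH w0 by (auto simp: \<eta>_def)
      have 1: "- 5 * \<eta>\<^sup>2 * E w w \<le> E (\<lambda>x. \<sigma> k x * (w x)\<^sup>2) (\<sigma> k)"
        by (rule E_small_square_weight) (use \<sigma> \<eta> w w0 in \<open>auto simp: \<eta>_def\<close>)
      have "nrm (\<lambda>x. \<sigma> k x * w x) \<le> 2 * (sqrt H * nrm (\<sigma> k) + \<eta> * nrm w)"
        by (rule nrm_mult_le) (use \<sigma> w \<eta> H b in auto)
      also have "\<dots> \<le> 2 * (sqrt H * nrm f + \<eta> * nrm w)"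
        using mult_left_mono[OF \<sigma>(4)[of k], of "sqrt H"] H by simp
      finally have "nrm (\<lambda>x. \<sigma> k x * w x) * nrm (\<sigma> k) \<le> 2 * (sqrt H * nrm f + \<eta> * nrm w) * nrm f"
        using \<sigma> f w H \<eta> by (intro mult_mono) auto
      moreover have "\<bar>E (\<lambda>x. \<sigma> k x * w x) (\<sigma> k)\<bar> \<le> nrm (\<lambda>x. \<sigma> k x * w x) * nrm (\<sigma> k)"
        using \<sigma> w by (intro E_cauchy_schwarz) auto
      ultimately have "- (2 * (sqrt H * nrm f + \<eta> * nrm w) * nrm f) \<le> E (\<lambda>x. \<sigma> k x * w x) (\<sigma> k)"
        by linarith
      hence 2: "2 * e * (- (2 * (sqrt H * nrm f + \<eta> * nrm w) * nrm f)) \<le> 2 * e * E (\<lambda>x. \<sigma> k x * w x) (\<sigma> k)"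
        using e by (intro mult_left_mono) auto
      have "\<bar>E (\<lambda>x. (\<sigma> k x)\<^sup>2) h\<bar> \<le> nrm (\<lambda>x. (\<sigma> k x)\<^sup>2) * nrm h"
        using \<sigma> h by (intro E_cauchy_schwarz) auto
      also have "\<dots> \<le> (2 * \<eta> * nrm (\<sigma> k)) * nrm h"
        using nrm_square_le[OF \<sigma>(1)[of k] _ b(1)] \<eta> h by (intro mult_right_mono) auto
      also have "\<dots> \<le> (2 * \<eta> * nrm f) * nrm h"
        using \<sigma>(4)[of k] \<eta> h by (intro mult_right_mono mult_left_mono) auto
      finally have 3: "E (\<lambda>x. (\<sigma> k x)\<^sup>2) h \<le> 2 * \<eta> * nrm f * nrm h" by simp
      have "(\<lambda>x. \<sigma> k x * h x) = (\<lambda>x. \<sigma> k x * (w x)\<^sup>2 + (2 * e) * (\<sigma> k x * w x))"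
        unfolding hw by (simp add: algebra_simps)
      hence "E (\<lambda>x. \<sigma> k x * h x) (\<sigma> k) = E (\<lambda>x. \<sigma> k x * (w x)\<^sup>2) (\<sigma> k) + 2 * e * E (\<lambda>x. \<sigma> k x * w x) (\<sigma> k)"
        using \<sigma> w by (simp add: E_add_left E_scale_left)
      hence "L_fun E (\<sigma> k) h = 2 * (E (\<lambda>x. \<sigma> k x * (w x)\<^sup>2) (\<sigma> k) + 2 * e * E (\<lambda>x. \<sigma> k x * w x) (\<sigma> k))
        - E (\<lambda>x. (\<sigma> k x)\<^sup>2) h" by (simp add: L_fun_def)
      thus ?thesis using 1 2 3 \<sigma>(5)[of k] unfolding q_def \<eta>_def[symmetric]
        by (simp add: algebra_simps)
    qed
    have "(\<lambda>k. - 10 * (C / 2 ^ k)\<^sup>2 * E w w - 8 * e * (sqrt H * nrm f + C / 2 ^ k * nrm w) * nrm f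
      - 2 * (C / 2 ^ k) * nrm f * nrm h) \<longlonglongrightarrow>
      - 10 * 0\<^sup>2 * E w w - 8 * e * (sqrt H * nrm f + 0 * nrm w) * nrm f - 2 * 0 * nrm f * nrm h"
      by (intro tendsto_intros halving_tendsto_0)
    from LIMSEQ_le_const2[OF this] low
    have "- (8 * e * (sqrt H * nrm f) * nrm f) \<le> L_fun E f h" by force
    thus ?thesis using nrm_power2[OF f(1)] by (simp add: power2_eq_square mult.assoc)
  qed
  have A: "((\<lambda>e. - (8 * e * sqrt H * E f f)) \<longlongrightarrow> - (8 * 0 * sqrt H * E f f)) (at_right 0)"
    by (intro tendsto_intros)
  have B: "eventually (\<lambda>e. - (8 * e * sqrt H * E f f) \<le> L_fun E f h) (at_right 0)"
    using main by (auto simp: eventually_at_filter intro!: always_eventually)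
  have "- (8 * 0 * sqrt H * E f f) \<le> L_fun E f h"
    by (rule tendsto_upperbound[OF A B]) simp
  thus ?thesis by simp
qed

section \<open>Signed functions, upper bound and threshold estimate\<close>

abbreviation pos :: "('a \<Rightarrow> real) \<Rightarrow> 'a \<Rightarrow> real" where "pos f \<equiv> \<lambda>x. max (f x) 0"
abbreviation neg :: "('a \<Rightarrow> real) \<Rightarrow> 'a \<Rightarrow> real" where "neg f \<equiv> \<lambda>x. max (- f x) 0"

lemma E_pos_neg_le:
  assumes "f \<in> D" shows "E (pos f) (pos f) \<le> E f f" "E (neg f) (neg f) \<le> E f f"
proof -
  have "normal_contraction (\<lambda>t. max t 0)" "normal_contraction (\<lambda>t. max (- t) 0)"
    by (auto simp: normal_contraction_def)
  thus "E (pos f) (pos f) \<le> E f f" "E (neg f) (neg f) \<le> E f f"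
    using E_comp_le[OF assms] by blast+
qed

text \<open>As f^+ f^- = 0, only E(f^+ h, f^-) and E(f^- h, f^+) remain in the polar form. Both are
  nonpositive because the supports are disjoint, and in f = f^+ - f^- the polar form enters with a
  minus sign.\<close>

lemma L_fun_pos_neg_le:
  assumes f: "f \<in> D" and h: "h \<in> D" "\<And>x. 0 \<le> h x"
  shows "L_fun E (pos f) h + L_fun E (neg f) h \<le> L_fun E f h"
proof -
  have D: "pos f \<in> D" "neg f \<in> D" using f by simp_all
  have z: "(\<lambda>x. pos f x * neg f x) = (\<lambda>x. 0)" by (auto simp: max_def)
  have "E (\<lambda>x. pos f x * h x) (neg f) \<le> 0" "E (\<lambda>x. neg f x * h x) (pos f) \<le> 0"
    using D h by (intro E_disjoint_nonpos; auto simp: max_def)+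
  hence "L_pair (pos f) (neg f) h \<le> 0" unfolding L_pair_def z using h by simp
  moreover have "(\<lambda>x. pos f x - neg f x) = f" by (auto simp: max_def)
  ultimately show ?thesis using L_fun_diff[OF D h(1)] by simp
qed

lemma L_fun_nonneg:
  assumes f: "f \<in> D" and h: "h \<in> D" "\<And>x. 0 \<le> h x"
  shows "0 \<le> L_fun E f h"
  using L_fun_pos_neg_le[OF f h] L_fun_nonneg_of_nonneg[of "pos f" h] L_fun_nonneg_of_nonneg[of "neg f" h]
    f h by simp

lemma L_fun_mono:
  assumes f: "f \<in> D" and "g \<in> D" "h \<in> D" "\<And>x. g x \<le> h x"
  shows "L_fun E f g \<le> L_fun E f h"
  using L_fun_nonneg[OF f, of "\<lambda>x. h x - g x"] assms by (simp add: L_fun_diff_arg)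

lemma L_fun_diff_le:
  assumes "f \<in> D" "g \<in> D" "h \<in> D" "\<And>x. 0 \<le> h x"
  shows "L_fun E (\<lambda>x. f x - g x) h \<le> 2 * (L_fun E f h + L_fun E g h)"
  using L_fun_nonneg[of "\<lambda>x. f x + g x" h] assms by (simp add: L_fun_diff L_fun_add)

lemma L_fun_add_le:
  assumes "f \<in> D" "g \<in> D" "h \<in> D" "\<And>x. 0 \<le> h x"
  shows "L_fun E (\<lambda>x. f x + g x) h \<le> 2 * (L_fun E f h + L_fun E g h)"
  using L_fun_nonneg[of "\<lambda>x. f x - g x" h] assms by (simp add: L_fun_diff L_fun_add)

text \<open>On layers the polar form of 2 E(u) - L_u(h) is E(r + (c - r) h, s) + E(r, s (1 - h)).
  The function r + (c - r) h is a convex combination of r and c, so both terms fall under the unit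
  rule. Along the folded functions the product bound leaves -4 E(f) in the limit, hence 6 = 2 +
  4.\<close>

lemma L_fun_le_of_nonneg:
  assumes f: "f \<in> D" "\<And>x. 0 \<le> f x" and h: "h \<in> D" "\<And>x. 0 \<le> h x" "\<And>x. h x \<le> 1"
  shows "L_fun E f h \<le> 6 * E f f"
proof -
  obtain C where C: "C > 0" "\<And>x. f x \<le> C" using D_upper_bound[OF f(1)] by blast
  define q where "q u = 2 * E u u - L_fun E u h" for u
  have q: "q (\<lambda>x. r x - s x) \<le> q (\<lambda>x. r x + s x)"
    if r: "r \<in> D" and s: "s \<in> D" and c: "c > 0" and r0: "\<And>x. 0 \<le> r x" and rc: "\<And>x. r x \<le> c"
      and s0: "\<And>x. 0 \<le> s x" and rs: "\<And>x. s x > 0 \<Longrightarrow> r x = c" for r s c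
  proof -
    have rs': "r x * s x = c * s x" for x using s0[of x] rs[of x] by (cases "s x = 0") auto
    have "0 \<le> E (\<lambda>x. r x + (c * h x - r x * h x)) s"
    proof (rule E_unit_nonneg[of _ _ c])
      fix x
      have "0 \<le> (c - r x) * (1 - h x)" using rc h by (intro mult_nonneg_nonneg) auto
      thus "r x + (c * h x - r x * h x) \<le> c" by (simp add: algebra_simps)
    qed (use r s h c s0 rs in auto)
    moreover have "0 \<le> E r (\<lambda>x. s x - s x * h x)"
    proof (rule E_unit_nonneg[of _ _ c])
      fix x show "0 \<le> s x - s x * h x" using mult_left_mono[OF h(3)[of x] s0[of x]] by simp
      assume "0 < s x - s x * h x"
      hence "s x \<noteq> 0" by auto
      thus "r x = c" using s0[of x] rs[of x] by force
    qed (use r s h c rc in auto)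
    moreover have "2 * E r s - L_pair r s h
        = E (\<lambda>x. r x + (c * h x - r x * h x)) s + E r (\<lambda>x. s x - s x * h x)"
      unfolding L_pair_def rs' using r s h by (simp add: E_bilinear E_sym[of s h] E_sym[of "\<lambda>x. s x * h x" r])
    ultimately show ?thesis
      using r s h by (simp add: q_def L_fun_add L_fun_diff E_bilinear E_sym[of s r])
  qed
  obtain \<sigma> where \<sigma>: "\<And>k::nat. \<sigma> k \<in> D" "\<And>k x. 0 \<le> \<sigma> k x" "\<And>k x. \<sigma> k x \<le> C / 2 ^ k"
    "\<And>k. nrm (\<sigma> k) \<le> nrm f" "\<And>k. q (\<sigma> k) \<le> q f"
    by (rule fold_sequence[OF f(1) C(1) f(2) C(2), of q]) (use q in blast)+
  have low: "- 4 * (nrm f + C / 2 ^ k * nrm h) * nrm f - 2 * (C / 2 ^ k) * nrm f * nrm h \<le> q f" for k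
  proof -
    define \<eta> where "\<eta> = C / 2 ^ k"
    have \<eta>: "\<eta> > 0" using C by (simp add: \<eta>_def)
    have b: "\<bar>\<sigma> k x\<bar> \<le> \<eta>" "\<bar>h x\<bar> \<le> 1" for x using \<sigma> h by (auto simp: \<eta>_def)
    have "nrm (\<lambda>x. \<sigma> k x * h x) \<le> 2 * (1 * nrm (\<sigma> k) + \<eta> * nrm h)"
      by (rule nrm_mult_le) (use \<sigma> h \<eta> b in auto)
    also have "\<dots> \<le> 2 * (nrm f + \<eta> * nrm h)" using \<sigma>(4)[of k] by simp
    finally have "nrm (\<lambda>x. \<sigma> k x * h x) * nrm (\<sigma> k) \<le> 2 * (nrm f + \<eta> * nrm h) * nrm f"
      using \<sigma> f h \<eta> by (intro mult_mono) auto
    moreover have "\<bar>E (\<lambda>x. \<sigma> k x * h x) (\<sigma> k)\<bar> \<le> nrm (\<lambda>x. \<sigma> k x * h x) * nrm (\<sigma> k)"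
      using \<sigma> h by (intro E_cauchy_schwarz) auto
    ultimately have 1: "E (\<lambda>x. \<sigma> k x * h x) (\<sigma> k) \<le> 2 * (nrm f + \<eta> * nrm h) * nrm f" by linarith
    have "\<bar>E (\<lambda>x. (\<sigma> k x)\<^sup>2) h\<bar> \<le> nrm (\<lambda>x. (\<sigma> k x)\<^sup>2) * nrm h"
      using \<sigma> h by (intro E_cauchy_schwarz) auto
    also have "\<dots> \<le> (2 * \<eta> * nrm (\<sigma> k)) * nrm h"
      using nrm_square_le[OF \<sigma>(1)[of k] _ b(1)] \<eta> h by (intro mult_right_mono) auto
    also have "\<dots> \<le> (2 * \<eta> * nrm f) * nrm h"
      using \<sigma>(4)[of k] \<eta> h by (intro mult_right_mono mult_left_mono) auto
    finally have 3: "- (2 * \<eta> * nrm f * nrm h) \<le> E (\<lambda>x. (\<sigma> k x)\<^sup>2) h" by simp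
    have "0 \<le> E (\<sigma> k) (\<sigma> k)" using \<sigma> by simp
    thus ?thesis using 1 3 \<sigma>(5)[of k] unfolding q_def[of "\<sigma> k"] L_fun_def \<eta>_def[symmetric]
      by (simp add: algebra_simps)
  qed
  have "(\<lambda>k. - 4 * (nrm f + C / 2 ^ k * nrm h) * nrm f - 2 * (C / 2 ^ k) * nrm f * nrm h)
    \<longlonglongrightarrow> - 4 * (nrm f + 0 * nrm h) * nrm f - 2 * 0 * nrm f * nrm h"
    by (intro tendsto_intros halving_tendsto_0)
  from LIMSEQ_le_const2[OF this] low
  have "- 4 * nrm f * nrm f \<le> q f" by force
  thus ?thesis using nrm_power2[OF f(1)] by (simp add: q_def power2_eq_square)
qed

lemma L_fun_le:
  assumes f: "f \<in> D" and h: "h \<in> D" "\<And>x. 0 \<le> h x" "\<And>x. h x \<le> 1"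
  shows "L_fun E f h \<le> 24 * E f f"
proof -
  have D: "pos f \<in> D" "neg f \<in> D" using f by simp_all
  have "(\<lambda>x. pos f x - neg f x) = f" by (auto simp: max_def)
  hence "L_fun E f h \<le> 2 * (L_fun E (pos f) h + L_fun E (neg f) h)"
    using L_fun_diff_le[OF D h(1,2)] by simp
  moreover have "L_fun E (pos f) h \<le> 6 * E (pos f) (pos f)" "L_fun E (neg f) h \<le> 6 * E (neg f) (neg f)"
    using D h by (auto intro!: L_fun_le_of_nonneg)
  \<comment> \<open>24 = 2 (6 + 6), as each of the two parts has at most the energy of f.\<close>
  moreover have "l \<le> 2 * (x + y) \<Longrightarrow> x \<le> 6 * a \<Longrightarrow> y \<le> 6 * b \<Longrightarrow> a \<le> e \<Longrightarrow> b \<le> e \<Longrightarrow> l \<le> 24 * e"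
    for l x y a b e :: real by argo
  ultimately show ?thesis using E_pos_neg_le[OF f] by blast
qed

text \<open>The energy of the part of \<open>f\<close> above a level is controlled by the energy measure of the set
  where that part lives: a jump of \<open>p = (f - \<delta>)\<^sup>+\<close> has at least one end point in that set.\<close>

lemma E_threshold_le_of_nonneg:
  assumes f: "f \<in> D" "\<And>x. 0 \<le> f x" and h: "h \<in> D" "\<And>x. 0 \<le> h x" "\<And>x. h x \<le> 1"
    and \<delta>: "\<delta> > 0" "\<And>x. f x > \<delta> \<Longrightarrow> h x = 1"
  shows "E (\<lambda>x. max (f x - \<delta>) 0) (\<lambda>x. max (f x - \<delta>) 0) \<le> L_fun E f h"
proof -
  define p where "p = (\<lambda>x. max (f x - \<delta>) 0)"
  define g where "g = (\<lambda>x. min (f x) \<delta>)"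
  have D: "p \<in> D" "g \<in> D" using f \<delta> by (auto simp: p_def g_def)
  have p0: "0 \<le> p x" and hp: "p x \<noteq> 0 \<Longrightarrow> h x = 1" for x
    using \<delta>(2)[of x] by (auto simp: p_def max_def split: if_splits)
  obtain C where C: "C > 0" "\<And>x. p x \<le> C" using D_upper_bound[OF D(1)] by blast
  \<comment> \<open>As h = 1 where p \<noteq> 0, L_p(h) = 2 E(p) - E(p^2, h) = E(p) + q(p), so the
    claim for \<open>p\<close> is q(p) \<ge> 0. On layers the polar form of \<open>q\<close> is E(r
    - c h, s), and r - c h \<le> 0 with equality where s > 0; this uses that r vanishes with
    p.\<close>
  define q where "q u = E u u - E (\<lambda>x. (u x)\<^sup>2) h" for u
  have q: "q (\<lambda>x. r x - s x) \<le> q (\<lambda>x. r x + s x)"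
    if r: "r \<in> D" and s: "s \<in> D" and c: "c > 0" and r0: "\<And>x. 0 \<le> r x" and rc: "\<And>x. r x \<le> c"
      and s0: "\<And>x. 0 \<le> s x" and rs: "\<And>x. s x > 0 \<Longrightarrow> r x = c" and rp: "\<And>x. p x = 0 \<Longrightarrow> r x = 0"
    for r s c
  proof -
    have rs': "r x * s x = c * s x" for x using s0[of x] rs[of x] by (cases "s x = 0") auto
    have "0 \<le> E (\<lambda>x. r x - c * h x) s"
    proof (rule E_unit_nonneg[of _ _ 0])
      fix x
      show "r x - c * h x \<le> 0" using rc[of x] hp[of x] rp[of x] h(2)[of x] c by (cases "p x = 0") auto
      show "0 < s x \<Longrightarrow> r x - c * h x = 0" using rs[of x] hp[of x] rp[of x] c by auto
    qed (use r s h s0 in auto)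
    hence X: "0 \<le> E r s - c * E s h" using r s h by (simp add: E_bilinear E_sym[of s h])
    have sq: "(r x + s x)\<^sup>2 = (r x)\<^sup>2 + 2 * (c * s x) + (s x)\<^sup>2"
      "(r x - s x)\<^sup>2 = (r x)\<^sup>2 - 2 * (c * s x) + (s x)\<^sup>2" for x
      using rs'[of x] by (auto simp: power2_eq_square algebra_simps)
    show ?thesis
      using r s h X unfolding q_def sq by (simp add: E_bilinear E_sym[of s r])
  qed
  obtain \<sigma> where \<sigma>: "\<And>k::nat. \<sigma> k \<in> D" "\<And>k x. 0 \<le> \<sigma> k x" "\<And>k x. \<sigma> k x \<le> C / 2 ^ k"
    "\<And>k. nrm (\<sigma> k) \<le> nrm p" "\<And>k. q (\<sigma> k) \<le> q p"
    by (rule fold_sequence[OF D(1) C(1) p0 C(2), of q]) (use q in blast)+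
  have low: "- (2 * (C / 2 ^ k) * nrm p * nrm h) \<le> q p" for k
  proof -
    define \<eta> where "\<eta> = C / 2 ^ k"
    have \<eta>: "\<eta> > 0" using C by (simp add: \<eta>_def)
    have b: "\<bar>\<sigma> k x\<bar> \<le> \<eta>" for x using \<sigma> by (auto simp: \<eta>_def)
    have "\<bar>E (\<lambda>x. (\<sigma> k x)\<^sup>2) h\<bar> \<le> nrm (\<lambda>x. (\<sigma> k x)\<^sup>2) * nrm h"
      using \<sigma> h by (intro E_cauchy_schwarz) auto
    also have "\<dots> \<le> (2 * \<eta> * nrm (\<sigma> k)) * nrm h"
      using nrm_square_le[OF \<sigma>(1)[of k] _ b(1)] \<eta> h by (intro mult_right_mono) auto
    also have "\<dots> \<le> (2 * \<eta> * nrm p) * nrm h"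
      using \<sigma>(4)[of k] \<eta> h by (intro mult_right_mono mult_left_mono) auto
    finally have "E (\<lambda>x. (\<sigma> k x)\<^sup>2) h \<le> 2 * \<eta> * nrm p * nrm h" by simp
    moreover have "0 \<le> E (\<sigma> k) (\<sigma> k)" using \<sigma> by simp
    ultimately show ?thesis using \<sigma>(5)[of k] unfolding q_def[of "\<sigma> k"] \<eta>_def[symmetric] by linarith
  qed
  have "(\<lambda>k. - (2 * (C / 2 ^ k) * nrm p * nrm h)) \<longlonglongrightarrow> - (2 * 0 * nrm p * nrm h)"
    by (intro tendsto_intros halving_tendsto_0)
  from LIMSEQ_le_const2[OF this] low
  have qp: "0 \<le> q p" by force
  have "(\<lambda>x. p x * h x) = p" using hp by (auto simp: fun_eq_iff)
  hence "E p p \<le> L_fun E p h" using qp by (simp add: q_def L_fun_def)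
  \<comment> \<open>From \<open>p\<close> to \<open>f\<close>: g = min(f, \<delta>) and p are layers
    at height \<delta> with sum f, so L_f(h) \<ge> L_p(h).\<close>
  moreover have "0 \<le> L_pair g p h"
  proof (rule L_pair_layers_nonneg[of _ _ _ \<delta>])
    show "p x > 0 \<Longrightarrow> g x = \<delta>" for x by (auto simp: p_def g_def max_def split: if_splits)
  qed (use D h \<delta> f p0 in \<open>auto simp: g_def\<close>)
  moreover have "0 \<le> L_fun E g h" using D h by (intro L_fun_nonneg) auto
  moreover have "(\<lambda>x. g x + p x) = f" by (auto simp: g_def p_def)
  ultimately have "E p p \<le> L_fun E f h" using L_fun_add[OF D(2,1) h(1)] by simp
  thus ?thesis by (simp add: p_def)
qed

lemma E_threshold_le:
  assumes f: "f \<in> D" and h: "h \<in> D" "\<And>x. 0 \<le> h x" "\<And>x. h x \<le> 1"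
    and \<delta>: "\<delta> > 0" "\<And>x. \<bar>f x\<bar> > \<delta> \<Longrightarrow> h x = 1"
    and p: "p = (\<lambda>x. f x - max (- \<delta>) (min (f x) \<delta>))"
  shows "E p p \<le> 2 * L_fun E f h"
proof -
  define a where "a = (\<lambda>x. max (pos f x - \<delta>) 0)"
  define b where "b = (\<lambda>x. max (neg f x - \<delta>) 0)"
  have D: "a \<in> D" "b \<in> D" using f \<delta> by (auto simp: a_def b_def)
  have "E a a \<le> L_fun E (pos f) h"
    unfolding a_def by (rule E_threshold_le_of_nonneg) (use f h \<delta> in \<open>auto simp: less_max_iff_disj\<close>)
  moreover have "E b b \<le> L_fun E (neg f) h"
    unfolding b_def by (rule E_threshold_le_of_nonneg) (use f h \<delta> in \<open>auto simp: less_max_iff_disj\<close>)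
  moreover have "(\<lambda>x. a x - b x) = p"
    using \<delta>(1) by (auto simp: a_def b_def p max_def min_def fun_eq_iff)
  ultimately show ?thesis
    using E_diff_le[OF D] L_fun_pos_neg_le[OF f h(1,2)] by simp
qed

end

section \<open>Closability in the presence of an energy dominant measure\<close>

locale dominated_form = contraction_form D E
  for D :: "('a \<Rightarrow> real) set" and E :: "('a \<Rightarrow> real) \<Rightarrow> ('a \<Rightarrow> real) \<Rightarrow> real" +
  fixes chi0 :: "'a \<Rightarrow> real" and M :: "'a measure"
  assumes chi: "chi0 \<in> D" "\<forall>x. chi0 x > 0"
    and space: "space M = UNIV"
    and sets: "sets M = sigma_D D"
    and fin: "finite_measure M"
    and dom: "energy_dominant E D M"

sublocale dominated_form \<subseteq> finite_measure M by (rule fin)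

context dominated_form
begin

section \<open>Measurability and square integrability\<close>

lemma D_measurable: "f \<in> D \<Longrightarrow> f \<in> borel_measurable M"
proof (rule measurableI)
  fix B :: "real set" assume "f \<in> D" "B \<in> sets borel"
  hence "f -` B \<in> sigma_sets UNIV {f -` B | f B. f \<in> D \<and> B \<in> sets borel}"
    by (intro sigma_sets.Basic) auto
  thus "f -` B \<inter> Sigma_Algebra.space M \<in> Sigma_Algebra.sets M"
    by (simp add: space sets sigma_D_def)
qed simp

lemma D_sq_integrable:
  assumes "f \<in> D" shows "integrable M (\<lambda>x. (f x)\<^sup>2)"
proof -
  obtain B where "\<And>x. \<bar>f x\<bar> \<le> B" using D_bounded[OF assms] by blast
  hence "norm ((f x)\<^sup>2) \<le> B\<^sup>2" for x using power_mono[of "\<bar>f x\<bar>" B 2] by simp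
  moreover have "f \<in> borel_measurable M" using assms by (rule D_measurable)
  ultimately show ?thesis by (intro integrable_const_bound[where B="B\<^sup>2"]) auto
qed

definition sq_integrable :: "('a \<Rightarrow> real) \<Rightarrow> bool" where
  "sq_integrable u \<longleftrightarrow> u \<in> borel_measurable M \<and> integrable M (\<lambda>x. (u x)\<^sup>2)"

lemma sq_integrable_D: "f \<in> D \<Longrightarrow> sq_integrable f"
  by (simp add: sq_integrable_def D_measurable D_sq_integrable)

lemma sq_integrable_bound:
  assumes "u \<in> borel_measurable M" "sq_integrable v" "\<And>x. \<bar>u x\<bar> \<le> c * \<bar>v x\<bar>"
  shows "sq_integrable u"
proof -
  have "(u x)\<^sup>2 \<le> c\<^sup>2 * (v x)\<^sup>2" for x
    using power_mono[OF assms(3)[of x], of 2] by (simp add: power_mult_distrib)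
  hence le: "norm ((u x)\<^sup>2) \<le> norm (c\<^sup>2 * (v x)\<^sup>2)" for x by simp
  have [measurable]: "u \<in> borel_measurable M" by (rule assms(1))
  have "integrable M (\<lambda>x. c\<^sup>2 * (v x)\<^sup>2)" using assms(2) by (simp add: sq_integrable_def)
  hence "integrable M (\<lambda>x. (u x)\<^sup>2)"
    by (rule Bochner_Integration.integrable_bound) (use le in \<open>auto intro: always_eventually\<close>)
  thus ?thesis using assms by (simp add: sq_integrable_def)
qed

lemma square_add_le: "(a + b)\<^sup>2 \<le> 2 * (a\<^sup>2 + b\<^sup>2)" for a b :: real
  using sum_squares_bound[of a b] by (simp add: power2_sum)

lemma sq_integrable_add:
  assumes "sq_integrable u" "sq_integrable v" shows "sq_integrable (\<lambda>x. u x + v x)"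
proof -
  have le: "norm ((u x + v x)\<^sup>2) \<le> norm (2 * ((u x)\<^sup>2 + (v x)\<^sup>2))" for x
    using square_add_le[of "u x" "v x"] by simp
  have [measurable]: "u \<in> borel_measurable M" "v \<in> borel_measurable M"
    using assms by (auto simp: sq_integrable_def)
  have "integrable M (\<lambda>x. 2 * ((u x)\<^sup>2 + (v x)\<^sup>2))" using assms by (simp add: sq_integrable_def)
  hence "integrable M (\<lambda>x. (u x + v x)\<^sup>2)"
    by (rule Bochner_Integration.integrable_bound) (use le in \<open>auto intro: always_eventually\<close>)
  thus ?thesis using assms by (simp add: sq_integrable_def)
qed

lemma sq_integrable_scale: "sq_integrable u \<Longrightarrow> sq_integrable (\<lambda>x. c * u x)"
  by (auto simp: sq_integrable_def power_mult_distrib)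

lemma sq_integrable_diff: "sq_integrable u \<Longrightarrow> sq_integrable v \<Longrightarrow> sq_integrable (\<lambda>x. u x - v x)"
  using sq_integrable_add[of u "\<lambda>x. (-1) * v x"] sq_integrable_scale[of v "-1"] by simp

lemma sq_integrable_indicator: "A \<in> Sigma_Algebra.sets M \<Longrightarrow> sq_integrable (indicator A)"
  unfolding sq_integrable_def
  by (auto intro!: integrable_const_bound[where B=1] split: split_indicator)

lemma integral_sq_add_le:
  assumes "sq_integrable u" "sq_integrable v"
  shows "(\<integral>x. (u x + v x)\<^sup>2 \<partial>M) \<le> 2 * ((\<integral>x. (u x)\<^sup>2 \<partial>M) + (\<integral>x. (v x)\<^sup>2 \<partial>M))"
proof -
  have "(\<integral>x. (u x + v x)\<^sup>2 \<partial>M) \<le> (\<integral>x. 2 * ((u x)\<^sup>2 + (v x)\<^sup>2) \<partial>M)"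
    using sq_integrable_add[OF assms] assms square_add_le
    by (intro integral_mono) (auto simp: sq_integrable_def)
  thus ?thesis using assms by (simp add: sq_integrable_def)
qed

lemma integral_sq_triangle:
  assumes "sq_integrable u" "sq_integrable v" "sq_integrable w"
  shows "(\<integral>x. (u x - w x)\<^sup>2 \<partial>M) \<le> 2 * ((\<integral>x. (u x - v x)\<^sup>2 \<partial>M) + (\<integral>x. (v x - w x)\<^sup>2 \<partial>M))"
  using integral_sq_add_le[OF sq_integrable_diff[OF assms(1,2)] sq_integrable_diff[OF assms(2,3)]] by simp

section \<open>The sets {f > 0} and the energy set function\<close>

lemma positive_set_S: "f \<in> D \<Longrightarrow> {x. f x > 0} \<in> S_sets D"
  by (auto simp: S_sets_def)

text \<open>Here \<open>chi0\<close> stands in for the constant 1: the infimum in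
  \<open>energy_measure\<close> ranges over a nonempty family for every set.\<close>

lemma UNIV_in_S: "UNIV \<in> S_sets D"
  using positive_set_S[OF chi(1)] chi(2) by simp

lemma S_subset_sets: "B \<in> S_sets D \<Longrightarrow> B \<in> Sigma_Algebra.sets M"
proof -
  assume "B \<in> S_sets D"
  then obtain f where f: "f \<in> D" "B = {x. f x > 0}" by (auto simp: S_sets_def)
  have "{x \<in> Sigma_Algebra.space M. f x > 0} \<in> Sigma_Algebra.sets M"
    using D_measurable[OF f(1)] by measurable
  thus ?thesis by (simp add: f space)
qed

text \<open>A real supremum is meaningful only for a bounded family; the bound 24 E(f) is uniform in
  B.\<close>

lemma energy_S_bdd_above:
  assumes "f \<in> D"
  shows "bdd_above (L_fun E f ` {h\<in>D. \<forall>x. 0 \<le> h x \<and> h x \<le> indicator B x})"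
proof (rule bdd_aboveI2)
  fix h assume h: "h \<in> {h\<in>D. \<forall>x. 0 \<le> h x \<and> h x \<le> indicator B x}"
  have "h x \<le> 1" for x using h by (auto intro: order_trans[OF _ indicator_le_1])
  thus "L_fun E f h \<le> 24 * E f f" using h assms by (intro L_fun_le) auto
qed

lemma L_fun_le_energy_S:
  assumes "f \<in> D" "h \<in> D" "\<And>x. 0 \<le> h x" "\<And>x. h x \<le> indicator B x"
  shows "L_fun E f h \<le> energy_S E D f B"
  unfolding energy_S_def using assms by (intro cSUP_upper energy_S_bdd_above) auto

lemma energy_S_leI:
  assumes "\<And>h. h \<in> D \<Longrightarrow> (\<And>x. 0 \<le> h x) \<Longrightarrow> (\<And>x. h x \<le> indicator B x) \<Longrightarrow> L_fun E f h \<le> c"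
  shows "energy_S E D f B \<le> c"
  unfolding energy_S_def
proof (rule cSUP_least)
  have "(\<lambda>x. 0) \<in> {h\<in>D. \<forall>x. 0 \<le> h x \<and> h x \<le> indicator B x}" by simp
  thus "{h\<in>D. \<forall>x. 0 \<le> h x \<and> h x \<le> indicator B x} \<noteq> {}" by blast
qed (use assms in auto)

lemma energy_S_mono:
  assumes "f \<in> D" "A \<subseteq> B" shows "energy_S E D f A \<le> energy_S E D f B"
proof (rule energy_S_leI)
  fix h :: "'a \<Rightarrow> real" assume h: "h \<in> D" "\<And>x. 0 \<le> h x" "\<And>x. h x \<le> indicator A x"
  have "h x \<le> indicator B x" for x
    using h(3)[of x] assms(2) by (auto split: split_indicator_asm split_indicator)
  thus "L_fun E f h \<le> energy_S E D f B" using h assms by (intro L_fun_le_energy_S) auto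
qed

lemma energy_S_nonneg: "f \<in> D \<Longrightarrow> 0 \<le> energy_S E D f B"
  using L_fun_le_energy_S[of f "\<lambda>x. 0" B] L_fun_nonneg[of f "\<lambda>x. 0"] by simp

lemma energy_measure_le:
  assumes "f \<in> D" "B \<in> S_sets D" "A \<subseteq> B"
  shows "energy_measure E D f A \<le> energy_S E D f B"
  unfolding energy_measure_def
  using assms energy_S_nonneg[OF assms(1)] by (intro cINF_lower bdd_belowI2[where m=0]) auto

lemma energy_measure_greatest:
  assumes "\<And>B. B \<in> S_sets D \<Longrightarrow> A \<subseteq> B \<Longrightarrow> c \<le> energy_S E D f B"
  shows "c \<le> energy_measure E D f A"
  unfolding energy_measure_def using assms UNIV_in_S by (intro cINF_greatest) auto

lemma energy_measure_S:
  assumes "f \<in> D" "B \<in> S_sets D"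
  shows "energy_measure E D f B = energy_S E D f B"
  using assms by (intro antisym energy_measure_le energy_measure_greatest energy_S_mono) auto

text \<open>Energy dominance speaks of sets; here it is turned into a statement on functions. The
  part of |h| below a small level \<eta> costs at most 24 \<eta> E(f). The part above lives on {|h|
  > \<eta>}, whose measure is small by Chebyshev's inequality and whose energy measure is therefore
  small. The sup bound C is used because the upper part divided by C has to be a competitor in
  \<open>energy_S\<close>.\<close>

lemma L_fun_small:
  assumes f: "f \<in> D" and C: "C > 0" and \<epsilon>: "\<epsilon> > 0"
  shows "\<exists>\<delta>>0. \<forall>h\<in>D. (\<forall>x. \<bar>h x\<bar> \<le> C) \<longrightarrow> (\<integral>x. (h x)\<^sup>2 \<partial>M) < \<delta> \<longrightarrow> \<bar>L_fun E f h\<bar> < \<epsilon>"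
proof -
  \<comment> \<open>The summand 1 keeps K positive when E(f) = 0.\<close>
  define K where "K = 24 * E f f + 1"
  have K: "K > 0" using f E_nonneg[of f] by (simp add: K_def add_nonneg_pos)
  define \<eta> where "\<eta> = \<epsilon> / (2 * K)"
  have \<eta>: "\<eta> > 0" using K \<epsilon> by (simp add: \<eta>_def)
  from dom f \<epsilon> C obtain d where d: "d > 0"
    "\<And>A. A \<in> gen_algebra (S_sets D) \<Longrightarrow> measure M A < d \<Longrightarrow> energy_measure E D f A < \<epsilon> / (2 * C)"
    unfolding energy_dominant_def by (metis divide_pos_pos mult_pos_pos zero_less_numeral)
  show ?thesis
  proof (intro exI[of _ "\<eta>\<^sup>2 * d"] conjI ballI impI)
    show "0 < \<eta>\<^sup>2 * d" using \<eta> d by simp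
  next
    fix h assume h: "h \<in> D" "\<forall>x. \<bar>h x\<bar> \<le> C" "(\<integral>x. (h x)\<^sup>2 \<partial>M) < \<eta>\<^sup>2 * d"
    define a where "a = (\<lambda>x. min \<bar>h x\<bar> \<eta>)"
    define b where "b = (\<lambda>x. max (\<bar>h x\<bar> - \<eta>) 0)"
    have ab: "a \<in> D" "b \<in> D" using h \<eta> by (auto simp: a_def b_def)
    define B where "B = {x. b x > 0}"
    have B: "B \<in> S_sets D" unfolding B_def using ab by (intro positive_set_S)
    have hB: "\<eta>\<^sup>2 * indicator B x \<le> (h x)\<^sup>2" for x
    proof (cases "x \<in> B")
      case True
      hence "\<eta> \<le> \<bar>h x\<bar>" by (auto simp: B_def b_def)
      from power_mono[OF this, of 2] True \<eta> show ?thesis by simp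
    qed simp
    have "\<eta>\<^sup>2 * measure M B = (\<integral>x. \<eta>\<^sup>2 * indicator B x \<partial>M)"
      using S_subset_sets[OF B] by (simp add: space)
    also have "\<dots> \<le> (\<integral>x. (h x)\<^sup>2 \<partial>M)"
      using S_subset_sets[OF B] hB D_sq_integrable[OF h(1)]
      by (intro integral_mono integrable_mult_right integrable_real_indicator) (auto simp: emeasure_eq_measure)
    finally have "\<eta>\<^sup>2 * measure M B < \<eta>\<^sup>2 * d" using h(3) by simp
    hence "measure M B < d" using \<eta> by simp
    hence eB: "energy_S E D f B < \<epsilon> / (2 * C)"
      using d(2)[OF gen_base[OF B]] energy_measure_S[OF f B] by simp
    have "L_fun E f (\<lambda>x. (1/C) * b x) \<le> energy_S E D f B"
    proof (rule L_fun_le_energy_S[OF f])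
      show "(\<lambda>x. 1 / C * b x) \<in> D" using ab by (intro D_scale)
      show "0 \<le> 1 / C * b x" for x using C by (simp add: b_def)
      show "1 / C * b x \<le> indicator B x" for x
      proof (cases "x \<in> B")
        case True
        have "b x \<le> C" using h(2)[rule_format, of x] \<eta> C by (auto simp: b_def)
        thus ?thesis using True C by (simp add: field_simps)
      next
        case False
        hence "b x \<le> 0" by (simp add: B_def)
        thus ?thesis using False C by (simp add: divide_nonpos_pos)
      qed
    qed
    hence "L_fun E f b / C \<le> energy_S E D f B"
      using L_fun_scale_arg[OF f ab(2), of "1/C"] by simp
    hence "L_fun E f b / C < \<epsilon> / (2 * C)" using eB by simp
    hence Lb: "L_fun E f b < \<epsilon> / 2" using C by (simp add: field_simps)
    have "L_fun E f (\<lambda>x. (1/\<eta>) * a x) \<le> 24 * E f f"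
      by (rule L_fun_le[OF f D_scale[OF ab(1)]]) (use \<eta> in \<open>auto simp: a_def field_simps\<close>)
    hence "L_fun E f a / \<eta> \<le> 24 * E f f" using L_fun_scale_arg[OF f ab(1), of "1/\<eta>"] by simp
    hence "L_fun E f a / \<eta> < K" by (simp add: K_def)
    hence "L_fun E f a < K * \<eta>" using \<eta> by (simp add: pos_divide_less_eq)
    hence La: "L_fun E f a < \<epsilon> / 2" using K by (simp add: \<eta>_def)
    have "(\<lambda>x. \<bar>h x\<bar>) = (\<lambda>x. a x + b x)" by (auto simp: a_def b_def)
    hence "L_fun E f (\<lambda>x. \<bar>h x\<bar>) < \<epsilon>" using La Lb L_fun_plus_arg[OF f ab] by simp
    moreover have "L_fun E f h \<le> L_fun E f (\<lambda>x. \<bar>h x\<bar>)"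
      using f h by (intro L_fun_mono) auto
    moreover have "L_fun E f (\<lambda>x. (-1) * h x) \<le> L_fun E f (\<lambda>x. \<bar>h x\<bar>)"
      using f h by (intro L_fun_mono D_scale) auto
    hence "- L_fun E f h \<le> L_fun E f (\<lambda>x. \<bar>h x\<bar>)"
      using L_fun_scale_arg[OF f h(1), of "-1"] by simp
    ultimately show "\<bar>L_fun E f h\<bar> < \<epsilon>" by linarith
  qed
qed

lemma L_fun_tendsto_0:
  assumes f: "f \<in> D" and h: "\<And>k::nat. h k \<in> D" "\<And>k x. \<bar>h k x\<bar> \<le> C"
    and lim: "(\<lambda>k. \<integral>x. (h k x)\<^sup>2 \<partial>M) \<longlonglongrightarrow> 0"
  shows "(\<lambda>k. L_fun E f (h k)) \<longlonglongrightarrow> 0"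
proof (rule tendstoI)
  fix \<epsilon> :: real assume \<epsilon>: "\<epsilon> > 0"
  have C: "max C 1 > 0" by simp
  obtain d where d: "d > 0" "\<forall>h\<in>D. (\<forall>x. \<bar>h x\<bar> \<le> max C 1) \<longrightarrow> (\<integral>x. (h x)\<^sup>2 \<partial>M) < d \<longrightarrow> \<bar>L_fun E f h\<bar> < \<epsilon>"
    using L_fun_small[OF f C \<epsilon>] by blast
  have "eventually (\<lambda>k. (\<integral>x. (h k x)\<^sup>2 \<partial>M) < d) sequentially"
    using order_tendstoD(2)[OF lim d(1)] .
  thus "eventually (\<lambda>k. dist (L_fun E f (h k)) 0 < \<epsilon>) sequentially"
  proof eventually_elim
    case (elim k)
    have "\<bar>h k x\<bar> \<le> max C 1" for x using h(2)[of k x] by simp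
    thus ?case using d(2) h(1) elim by simp
  qed
qed

lemma E_Cauchy_nrm:
  assumes "\<And>n. f n \<in> D"
  shows "E_Cauchy E f \<longleftrightarrow> (\<forall>\<epsilon>>0. \<exists>N. \<forall>n\<ge>N. \<forall>k\<ge>N. nrm (\<lambda>x. f n x - f k x) < \<epsilon>)"
proof -
  have *: "nrm u < \<epsilon> \<longleftrightarrow> E u u < \<epsilon>\<^sup>2" if "\<epsilon> > 0" for u \<epsilon>
    using that real_sqrt_less_iff[of "E u u" "\<epsilon>\<^sup>2"] by (simp add: nrm_def)
  show ?thesis
  proof
    assume "E_Cauchy E f"
    thus "\<forall>\<epsilon>>0. \<exists>N. \<forall>n\<ge>N. \<forall>k\<ge>N. nrm (\<lambda>x. f n x - f k x) < \<epsilon>"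
      unfolding E_Cauchy_def by (simp add: *)
  next
    assume A: "\<forall>\<epsilon>>0. \<exists>N. \<forall>n\<ge>N. \<forall>k\<ge>N. nrm (\<lambda>x. f n x - f k x) < \<epsilon>"
    show "E_Cauchy E f" unfolding E_Cauchy_def
    proof (intro allI impI)
      fix \<epsilon> :: real assume "\<epsilon> > 0"
      thus "\<exists>N. \<forall>n\<ge>N. \<forall>k\<ge>N. E (\<lambda>x. f n x - f k x) (\<lambda>x. f n x - f k x) < \<epsilon>"
        using A[rule_format, of "sqrt \<epsilon>"] by (simp add: *)
    qed
  qed
qed

lemma nrm_tendsto_0_iff:
  assumes "\<And>n. f n \<in> D"
  shows "(\<lambda>n. nrm (f n)) \<longlonglongrightarrow> 0 \<longleftrightarrow> (\<lambda>n. E (f n) (f n)) \<longlonglongrightarrow> 0"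
proof
  assume "(\<lambda>n. nrm (f n)) \<longlonglongrightarrow> 0"
  from tendsto_power[OF this, of 2] show "(\<lambda>n. E (f n) (f n)) \<longlonglongrightarrow> 0"
    using assms by (simp add: nrm_power2)
next
  assume "(\<lambda>n. E (f n) (f n)) \<longlonglongrightarrow> 0"
  from tendsto_real_sqrt[OF this] show "(\<lambda>n. nrm (f n)) \<longlonglongrightarrow> 0"
    by (simp add: nrm_def)
qed

definition clamp :: "real \<Rightarrow> ('a \<Rightarrow> real) \<Rightarrow> 'a \<Rightarrow> real" where
  "clamp d f = (\<lambda>x. max (- d) (min (f x) d))"

lemma clamp_D: "f \<in> D \<Longrightarrow> d \<ge> 0 \<Longrightarrow> clamp d f \<in> D"
  unfolding clamp_def by (rule D_comp) (auto simp: normal_contraction_def)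

text \<open>The function h n = min(|f n| / d, 1) is 1 where |f n| > d and tends to 0 in L2, so the
  threshold estimate bounds the energy above the level by twice the value of L_{f n} at h n. The
  smallness of L_f(h) is not uniform in f, so f n is replaced by a fixed f N; the difference costs
  24 E(f n - f N), whatever h n is.\<close>

lemma E_above_level_tendsto_0:
  assumes f: "\<And>n. f n \<in> D" and cauchy: "E_Cauchy E f"
    and L2: "(\<lambda>n. \<integral>x. (f n x)\<^sup>2 \<partial>M) \<longlonglongrightarrow> 0" and d: "d > 0"
  shows "(\<lambda>n. nrm (\<lambda>x. f n x - clamp d (f n) x)) \<longlonglongrightarrow> 0"
proof -
  define p where "p n = (\<lambda>x. f n x - clamp d (f n) x)" for n
  define h where "h n = (\<lambda>x. min ((1/d) * \<bar>f n x\<bar>) 1)" for n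
  have p: "p n \<in> D" for n using f clamp_D[OF f, of d n] d by (simp add: p_def)
  have h: "h n \<in> D" for n unfolding h_def using f by (intro D_min_const D_scale D_abs) auto
  have h01: "0 \<le> h n x" "h n x \<le> 1" for n x using d by (auto simp: h_def)
  have hsq: "(h n x)\<^sup>2 \<le> (1/d)\<^sup>2 * (f n x)\<^sup>2" for n x
    using power_mono[of "h n x" "(1/d) * \<bar>f n x\<bar>" 2] h01[of n x]
    by (simp add: h_def power_mult_distrib power_divide)
  have "(\<lambda>n. \<integral>x. (h n x)\<^sup>2 \<partial>M) \<longlonglongrightarrow> 0"
  proof (rule tendsto_sandwich[of "\<lambda>_. 0"])
    show "(\<lambda>n. (1/d)\<^sup>2 * (\<integral>x. (f n x)\<^sup>2 \<partial>M)) \<longlonglongrightarrow> 0"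
      using tendsto_mult[OF tendsto_const L2, of "(1/d)\<^sup>2"] by simp
    have "(\<integral>x. (h n x)\<^sup>2 \<partial>M) \<le> (\<integral>x. (1/d)\<^sup>2 * (f n x)\<^sup>2 \<partial>M)" for n
      using hsq D_sq_integrable[OF h] D_sq_integrable[OF f]
      by (intro integral_mono integrable_mult_right) auto
    thus "eventually (\<lambda>n. (\<integral>x. (h n x)\<^sup>2 \<partial>M) \<le> (1/d)\<^sup>2 * (\<integral>x. (f n x)\<^sup>2 \<partial>M)) sequentially" by simp
  qed auto
  hence Lh: "(\<lambda>n. L_fun E g (h n)) \<longlonglongrightarrow> 0" if "g \<in> D" for g
    using that h h01 by (intro L_fun_tendsto_0[where C=1]) auto
  have "(\<lambda>n. E (p n) (p n)) \<longlonglongrightarrow> 0"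
  proof (rule LIMSEQ_I)
    fix \<epsilon> :: real assume \<epsilon>: "\<epsilon> > 0"
    \<comment> \<open>The bounds add up to 4 (1 + 24) \<epsilon> / 200 = \<epsilon> / 2.\<close>
    then obtain N where N: "\<And>n k. n \<ge> N \<Longrightarrow> k \<ge> N \<Longrightarrow> E (\<lambda>x. f n x - f k x) (\<lambda>x. f n x - f k x) < \<epsilon> / 200"
      using cauchy unfolding E_Cauchy_def by (metis divide_pos_pos zero_less_numeral)
    obtain K where K: "\<And>n. n \<ge> K \<Longrightarrow> L_fun E (f N) (h n) < \<epsilon> / 200"
      using order_tendstoD(2)[OF Lh[OF f], of "\<epsilon> / 200" N] \<epsilon>
      by (auto simp: eventually_sequentially)
    have "norm (E (p n) (p n) - 0) < \<epsilon>" if n: "n \<ge> max N K" for n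
    proof -
      define g where "g = (\<lambda>x. f n x - f N x)"
      have g: "g \<in> D" using f by (simp add: g_def)
      have "E (p n) (p n) \<le> 2 * L_fun E (f n) (h n)"
      proof (rule E_threshold_le[OF f h h01 d])
        show "h n x = 1" if "d < \<bar>f n x\<bar>" for x using that d by (simp add: h_def min_def field_simps)
      qed (auto simp: p_def clamp_def)
      also have "L_fun E (f n) (h n) \<le> 2 * (L_fun E (f N) (h n) + L_fun E g (h n))"
        using L_fun_add_le[OF f g h h01(1), of N] by (simp add: g_def)
      also have "L_fun E g (h n) \<le> 24 * E g g" using g h h01 by (intro L_fun_le) auto
      also have "E g g < \<epsilon> / 200" unfolding g_def using N n by auto
      also have "L_fun E (f N) (h n) < \<epsilon> / 200" using K n by auto
      finally have "E (p n) (p n) < \<epsilon>" using \<epsilon> by simp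
      thus ?thesis using E_nonneg[OF p] by simp
    qed
    thus "\<exists>no. \<forall>n\<ge>no. norm (E (p n) (p n) - 0) < \<epsilon>" by blast
  qed
  hence "(\<lambda>n. nrm (p n)) \<longlonglongrightarrow> 0" using nrm_tendsto_0_iff[of p] p by simp
  thus ?thesis by (simp add: p_def)
qed

lemma inverse_Suc_small: "\<epsilon> > 0 \<Longrightarrow> \<exists>N::nat. \<forall>n\<ge>N. inverse (real (Suc n)) < \<epsilon>"
  using order_tendstoD(2)[OF LIMSEQ_inverse_real_of_nat, of \<epsilon>] by (auto simp: eventually_sequentially)

lemma sup_norm_tendsto_0:
  assumes "\<And>n x. \<bar>g n x\<bar> \<le> e n" "e \<longlonglongrightarrow> 0"
  shows "(\<lambda>n. sup_norm (g n :: 'a \<Rightarrow> real)) \<longlonglongrightarrow> 0"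
proof (rule tendsto_sandwich[OF _ _ tendsto_const assms(2)])
  have "0 \<le> sup_norm (g n)" for n
  proof -
    \<comment> \<open>\<open>undefined\<close> serves as some point of the nonempty set X.\<close>
    have "\<bar>g n undefined\<bar> \<le> (SUP x. \<bar>g n x\<bar>)"
      using assms(1) by (intro cSUP_upper bdd_aboveI2[of _ _ "e n"]) auto
    thus ?thesis by (simp add: sup_norm_def)
  qed
  thus "\<forall>\<^sub>F n in sequentially. 0 \<le> sup_norm (g n)" by simp
  have "sup_norm (g n) \<le> e n" for n
    unfolding sup_norm_def using assms(1) by (intro cSUP_least) auto
  thus "\<forall>\<^sub>F n in sequentially. sup_norm (g n) \<le> e n" by simp
qed

text \<open>Cutting an \<open>L\<^sub>2\<close>-null, \<open>E\<close>-Cauchy sequence at small levels makes it uniformly small; the parts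
  cut off have small energy since they live on sets of small measure. This reduces the claim to
  sup-norm closability.\<close>

lemma L2_closable:
  assumes closable: "sup_norm_closable E D"
  shows "L2_closable E D M"
  unfolding L2_closable_def
proof (intro allI impI, elim conjE)
  fix f assume f: "\<forall>n. f n \<in> D" and cauchy: "E_Cauchy E f"
    and L2: "(\<lambda>n. \<integral>x. (f n x)\<^sup>2 \<partial>M) \<longlonglongrightarrow> 0"
  have fD: "f n \<in> D" for n using f by blast
  define e where "e j = inverse (real (Suc j))" for j
  have e: "e j > 0" for j by (simp add: e_def)
  \<comment> \<open>Diagonal choice: the level e j and the energy cut off at that level vanish
    together, and n j \<ge> j lets f (n j) inherit the Cauchy property.\<close>
  have "\<exists>n\<ge>j. nrm (\<lambda>x. f n x - clamp (e j) (f n) x) < e j" for j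
    using order_tendstoD(2)[OF E_above_level_tendsto_0[OF fD cauchy L2 e[of j]] e[of j]]
    by (auto simp: eventually_sequentially) (meson nle_le)
  then obtain n where n: "\<And>j. n j \<ge> j" "\<And>j. nrm (\<lambda>x. f (n j) x - clamp (e j) (f (n j)) x) < e j"
    by metis
  define g where "g j = clamp (e j) (f (n j))" for j
  define p where "p j = (\<lambda>x. f (n j) x - g j x)" for j
  have g: "g j \<in> D" for j unfolding g_def using fD e by (intro clamp_D) (auto simp: less_imp_le)
  have p: "p j \<in> D" for j unfolding p_def using fD g by simp
  have pe: "nrm (p j) < e j" for j using n by (simp add: p_def g_def)
  have "E_Cauchy E g" unfolding E_Cauchy_nrm[of g, OF g]
  proof (intro allI impI)
    fix \<epsilon> :: real assume \<epsilon>: "\<epsilon> > 0"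
    obtain N where N: "\<And>a b. a \<ge> N \<Longrightarrow> b \<ge> N \<Longrightarrow> nrm (\<lambda>x. f a x - f b x) < \<epsilon> / 3"
      using cauchy \<epsilon> unfolding E_Cauchy_nrm[of f, OF fD] by (metis divide_pos_pos zero_less_numeral)
    obtain K where K: "\<And>j. j \<ge> K \<Longrightarrow> e j < \<epsilon> / 3"
      using inverse_Suc_small[of "\<epsilon> / 3"] \<epsilon> unfolding e_def by auto
    have "nrm (\<lambda>x. g a x - g b x) < \<epsilon>" if ab: "a \<ge> max N K" "b \<ge> max N K" for a b
    proof -
      have "(\<lambda>x. g a x - g b x) = (\<lambda>x. (f (n a) x - f (n b) x) - (p a x - p b x))"
        by (auto simp: p_def)
      hence "nrm (\<lambda>x. g a x - g b x) \<le> nrm (\<lambda>x. f (n a) x - f (n b) x) + nrm (\<lambda>x. p a x - p b x)"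
        using nrm_diff[of "\<lambda>x. f (n a) x - f (n b) x" "\<lambda>x. p a x - p b x"] fD p by simp
      also have "nrm (\<lambda>x. p a x - p b x) \<le> nrm (p a) + nrm (p b)" using p by (intro nrm_diff)
      also have "nrm (\<lambda>x. f (n a) x - f (n b) x) < \<epsilon> / 3"
        using N n(1)[of a] n(1)[of b] ab by auto
      also have "nrm (p a) + nrm (p b) < \<epsilon> / 3 + \<epsilon> / 3"
        using pe[of a] pe[of b] K[of a] K[of b] ab by auto
      finally show ?thesis by simp
    qed
    thus "\<exists>N. \<forall>n\<ge>N. \<forall>k\<ge>N. nrm (\<lambda>x. g n x - g k x) < \<epsilon>" by blast
  qed
  moreover have "(\<lambda>j. sup_norm (g j)) \<longlonglongrightarrow> 0"
  proof (rule sup_norm_tendsto_0)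
    show "\<bar>g j x\<bar> \<le> e j" for j x using e[of j] by (auto simp: g_def clamp_def)
    show "e \<longlonglongrightarrow> 0" unfolding e_def by (rule LIMSEQ_inverse_real_of_nat)
  qed
  ultimately have "(\<lambda>j. E (g j) (g j)) \<longlonglongrightarrow> 0"
    using closable g unfolding sup_norm_closable_def by blast
  hence ng: "(\<lambda>j. nrm (g j)) \<longlonglongrightarrow> 0" using nrm_tendsto_0_iff[of g, OF g] by simp
  have "(\<lambda>n. nrm (f n)) \<longlonglongrightarrow> 0"
  proof (rule LIMSEQ_I)
    fix \<epsilon> :: real assume \<epsilon>: "\<epsilon> > 0"
    obtain N where N: "\<And>a b. a \<ge> N \<Longrightarrow> b \<ge> N \<Longrightarrow> nrm (\<lambda>x. f a x - f b x) < \<epsilon> / 3"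
      using cauchy \<epsilon> unfolding E_Cauchy_nrm[of f, OF fD] by (metis divide_pos_pos zero_less_numeral)
    obtain K where K: "\<And>j. j \<ge> K \<Longrightarrow> e j < \<epsilon> / 3"
      using inverse_Suc_small[of "\<epsilon> / 3"] \<epsilon> unfolding e_def by auto
    obtain J where J: "\<And>j. j \<ge> J \<Longrightarrow> nrm (g j) < \<epsilon> / 3"
      using order_tendstoD(2)[OF ng, of "\<epsilon> / 3"] \<epsilon> by (auto simp: eventually_sequentially)
    define j where "j = max N (max K J)"
    have jj: "N \<le> j" "K \<le> j" "J \<le> j" by (auto simp: j_def)
    have "norm (nrm (f m) - 0) < \<epsilon>" if "m \<ge> N" for m
    proof -
      \<comment> \<open>One j is enough: the Cauchy property carries the smallness of f (n j) = p j
        + g j over to all late members of the sequence.\<close>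
      have "f m = (\<lambda>x. (f m x - f (n j) x) + (p j x + g j x))" by (auto simp: p_def)
      hence "nrm (f m) \<le> nrm (\<lambda>x. f m x - f (n j) x) + nrm (\<lambda>x. p j x + g j x)"
        using nrm_add[of "\<lambda>x. f m x - f (n j) x" "\<lambda>x. p j x + g j x"] fD p g by simp
      also have "nrm (\<lambda>x. p j x + g j x) \<le> nrm (p j) + nrm (g j)" using p g by (intro nrm_add)
      also have "nrm (\<lambda>x. f m x - f (n j) x) < \<epsilon> / 3"
        using N[OF that, of "n j"] n(1)[of j] by (auto simp: j_def)
      also have "nrm (p j) + nrm (g j) < \<epsilon> / 3 + \<epsilon> / 3"
        using pe[of j] K[OF jj(2)] J[OF jj(3)] by linarith
      finally show ?thesis using nrm_nonneg[OF fD] by simp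
    qed
    thus "\<exists>no. \<forall>m\<ge>no. norm (nrm (f m) - 0) < \<epsilon>" by blast
  qed
  thus "(\<lambda>n. E (f n) (f n)) \<longlonglongrightarrow> 0" using nrm_tendsto_0_iff[of f, OF fD] by simp
qed

section \<open>The closure is a Dirichlet form\<close>


lemma integral_sq_tendsto_0:
  assumes u: "\<And>n::nat. u n \<in> borel_measurable M" "v \<in> borel_measurable M"
    and w: "sq_integrable w" "\<And>n x. \<bar>u n x - v x\<bar> \<le> w x"
    and lim: "\<And>x. (\<lambda>n. u n x) \<longlonglongrightarrow> v x"
  shows "(\<lambda>n. \<integral>x. (u n x - v x)\<^sup>2 \<partial>M) \<longlonglongrightarrow> 0"
proof -
  have [measurable]: "\<And>n. u n \<in> borel_measurable M" "v \<in> borel_measurable M" by (rule u)+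
  have "(\<lambda>n. \<integral>x. (u n x - v x)\<^sup>2 \<partial>M) \<longlonglongrightarrow> (\<integral>x. (0::real) \<partial>M)"
  proof (rule integral_dominated_convergence[where w="\<lambda>x. (w x)\<^sup>2"])
    show "integrable M (\<lambda>x. (w x)\<^sup>2)" using w by (simp add: sq_integrable_def)
    show "AE x in M. norm ((u n x - v x)\<^sup>2) \<le> (w x)\<^sup>2" for n
      using power_mono[OF w(2), of n _ 2] by simp
    have "(\<lambda>n. (u n x - v x)\<^sup>2) \<longlonglongrightarrow> (v x - v x)\<^sup>2" for x
      by (intro tendsto_intros lim)
    thus "AE x in M. (\<lambda>n. (u n x - v x)\<^sup>2) \<longlonglongrightarrow> 0" by simp
  qed auto
  thus ?thesis by simp
qed

lemma integral_sq_mono: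
  assumes "sq_integrable u" "sq_integrable v" "\<And>x. \<bar>u x\<bar> \<le> \<bar>v x\<bar>"
  shows "(\<integral>x. (u x)\<^sup>2 \<partial>M) \<le> (\<integral>x. (v x)\<^sup>2 \<partial>M)"
  using assms by (intro integral_mono) (auto simp: sq_integrable_def abs_le_square_iff)

lemma E_Cauchy_convergent:
  assumes f: "\<And>n. f n \<in> D" and "E_Cauchy E f"
  shows "convergent (\<lambda>n. E (f n) (f n))"
proof -
  have le: "\<bar>nrm (f n) - nrm (f k)\<bar> \<le> nrm (\<lambda>x. f n x - f k x)" for n k
  proof -
    have "nrm (f n) \<le> nrm (\<lambda>x. f n x - f k x) + nrm (f k)"
      using nrm_add[of "\<lambda>x. f n x - f k x" "f k"] f by simp
    moreover have "nrm (f k) \<le> nrm (f n) + nrm (\<lambda>x. f n x - f k x)"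
      using nrm_diff[of "f n" "\<lambda>x. f n x - f k x"] f by simp
    ultimately show ?thesis by linarith
  qed
  have "Cauchy (\<lambda>n. nrm (f n))"
  proof (rule CauchyI)
    fix \<epsilon> :: real assume "\<epsilon> > 0"
    then obtain N where N: "\<forall>n\<ge>N. \<forall>k\<ge>N. nrm (\<lambda>x. f n x - f k x) < \<epsilon>"
      using assms(2) unfolding E_Cauchy_nrm[of f, OF f] by blast
    thus "\<exists>N. \<forall>n\<ge>N. \<forall>k\<ge>N. norm (nrm (f n) - nrm (f k)) < \<epsilon>"
      using le_less_trans[OF le] by (intro exI[of _ N]) auto
  qed
  then obtain l where "(\<lambda>n. nrm (f n)) \<longlonglongrightarrow> l"
    using real_Cauchy_convergent convergent_def by blast
  from tendsto_power[OF this, of 2] show ?thesis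
    using f by (auto simp: nrm_power2 convergent_def)
qed

text \<open>Minimising \<open>E\<close> over shrinking \<open>L\<^sub>2\<close>-balls around \<open>v\<close> gives an \<open>E\<close>-Cauchy sequence by the
  parallelogram law.\<close>

lemma approx_seq_of_bounded_energy:
  assumes v: "sq_integrable v" and h: "\<And>k::nat. h k \<in> D"
    and L2: "(\<lambda>k. \<integral>x. (h k x - v x)\<^sup>2 \<partial>M) \<longlonglongrightarrow> 0"
    and e: "\<And>k. E (h k) (h k) \<le> e k" "e \<longlonglongrightarrow> l"
  shows "\<exists>g. approx_seq E D M g v \<and> lim (\<lambda>n. E (g n) (g n)) \<le> l"
proof -
  define r where "r n = inverse (real (Suc n))" for n
  have r: "r n > 0" for n by (simp add: r_def)
  have r_mono: "n \<le> m \<Longrightarrow> r m \<le> r n" for n m by (simp add: r_def)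
  have r0: "r \<longlonglongrightarrow> 0" unfolding r_def by (rule LIMSEQ_inverse_real_of_nat)
  define W where "W n = {g \<in> D. (\<integral>x. (g x - v x)\<^sup>2 \<partial>M) \<le> r n}" for n
  define d where "d n = (INF g\<in>W n. E g g)" for n
  have W_mono: "n \<le> m \<Longrightarrow> W m \<subseteq> W n" for n m using r_mono[of n m] by (auto simp: W_def)
  have hW: "eventually (\<lambda>k. h k \<in> W n) sequentially" for n
    using order_tendstoD(2)[OF L2 r[of n]] by eventually_elim (auto simp: W_def h)
  have ne: "W n \<noteq> {}" for n
    using eventually_happens'[OF _ hW[of n]] by auto
  have bdd: "bdd_below ((\<lambda>g. E g g) ` W n)" for n
    by (rule bdd_belowI2[of _ 0]) (auto simp: W_def)
  have d_le: "d n \<le> E g g" if "g \<in> W n" for n g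
    unfolding d_def using that by (intro cINF_lower bdd)
  have d_l: "d n \<le> l" for n
  proof (rule tendsto_lowerbound[OF e(2)])
    show "eventually (\<lambda>k. d n \<le> e k) sequentially"
      using hW[of n] by eventually_elim (rule order_trans[OF d_le e(1)])
  qed simp
  have "incseq d"
    unfolding d_def using ne bdd W_mono by (intro monoI cINF_superset_mono) auto
  then obtain L where L: "d \<longlonglongrightarrow> L" "\<forall>i. d i \<le> L"
    using incseq_convergent[of d l] d_l by blast
  have "\<exists>g\<in>W n. E g g < d n + r n" for n
    using cINF_less_iff[OF ne[of n] bdd[of n], of "d n + r n"] r[of n] unfolding d_def by simp
  then obtain g where g: "\<And>n. g n \<in> W n" "\<And>n. E (g n) (g n) < d n + r n" by metis
  have gD: "g n \<in> D" for n using g(1) by (auto simp: W_def)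
  have gv: "(\<integral>x. (g n x - v x)\<^sup>2 \<partial>M) \<le> r n" for n using g(1) by (auto simp: W_def)
  have par: "E (\<lambda>x. g n x - g m x) (\<lambda>x. g n x - g m x) \<le> 2 * (d m - d n) + 2 * r n + 2 * r m"
    if nm: "n \<le> m" for n m
  proof -
    \<comment> \<open>The midpoint stays in the larger ball \<open>W n\<close>, so its energy is at
      least d n. As \<open>d\<close> increases and is bounded by l, the difference d m - d n left by
      the parallelogram law becomes small.\<close>
    define a where "a = (\<lambda>x. (1/2) * (g n x + g m x))"
    have aD: "a \<in> D" unfolding a_def using gD by (intro D_scale D_add)
    have "(\<integral>x. (a x - v x)\<^sup>2 \<partial>M) = (\<integral>x. (1/4) * ((g n x - v x) + (g m x - v x))\<^sup>2 \<partial>M)"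
      by (rule Bochner_Integration.integral_cong) (auto simp: a_def power2_eq_square algebra_simps)
    also have "\<dots> \<le> (1/4) * (2 * ((\<integral>x. (g n x - v x)\<^sup>2 \<partial>M) + (\<integral>x. (g m x - v x)\<^sup>2 \<partial>M)))"
      using integral_sq_add_le[OF sq_integrable_diff[OF sq_integrable_D[OF gD[of n]] v]
        sq_integrable_diff[OF sq_integrable_D[OF gD[of m]] v]] by simp
    also have "\<dots> \<le> r n" using gv[of n] gv[of m] r_mono[OF nm] by simp
    finally have "a \<in> W n" using aD by (simp add: W_def)
    hence "d n \<le> E a a" by (rule d_le)
    moreover have "E a a = (1/2) * ((1/2) * E (\<lambda>x. g n x + g m x) (\<lambda>x. g n x + g m x))"
      unfolding a_def by (simp only: E_scale_left E_scale_right D_scale D_add gD)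
    ultimately have "4 * d n \<le> E (\<lambda>x. g n x + g m x) (\<lambda>x. g n x + g m x)" by simp
    hence "4 * d n \<le> E (g n) (g n) + 2 * E (g n) (g m) + E (g m) (g m)"
      using gD by (simp add: E_bilinear E_sym[of "g m" "g n"])
    moreover have "E (\<lambda>x. g n x - g m x) (\<lambda>x. g n x - g m x)
        = E (g n) (g n) - 2 * E (g n) (g m) + E (g m) (g m)"
      using gD by (simp add: E_bilinear E_sym[of "g m" "g n"])
    ultimately show ?thesis using g(2)[of n] g(2)[of m] by argo
  qed
  have "E_Cauchy E g" unfolding E_Cauchy_def
  proof (intro allI impI)
    fix \<epsilon> :: real assume \<epsilon>: "\<epsilon> > 0"
    have "eventually (\<lambda>n. r n < \<epsilon> / 8 \<and> L - \<epsilon> / 8 < d n) sequentially"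
      using order_tendstoD(2)[OF r0, of "\<epsilon> / 8"] order_tendstoD(1)[OF L(1), of "L - \<epsilon> / 8"] \<epsilon>
      by (auto intro: eventually_conj)
    then obtain N where N: "\<And>n. n \<ge> N \<Longrightarrow> r n < \<epsilon> / 8" "\<And>n. n \<ge> N \<Longrightarrow> L - \<epsilon> / 8 < d n"
      by (auto simp: eventually_sequentially)
    have *: "E (\<lambda>x. g n x - g m x) (\<lambda>x. g n x - g m x) < \<epsilon>" if "N \<le> n" "n \<le> m" for n m
    proof -
      have "r n < \<epsilon> / 8" "r m < \<epsilon> / 8" "L - \<epsilon> / 8 < d n" "d m \<le> L"
        using N L(2) that by auto
      thus ?thesis using par[OF that(2)] \<epsilon> by argo
    qed
    have "E (\<lambda>x. g n x - g k x) (\<lambda>x. g n x - g k x) < \<epsilon>" if "n \<ge> N" "k \<ge> N" for n k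
    proof (cases "n \<le> k")
      case False
      moreover have "E (\<lambda>x. g n x - g k x) (\<lambda>x. g n x - g k x) = E (\<lambda>x. g k x - g n x) (\<lambda>x. g k x - g n x)"
        using gD by (simp add: E_bilinear)
      ultimately show ?thesis using *[of k n] that by simp
    qed (use * that in simp)
    thus "\<exists>N. \<forall>n\<ge>N. \<forall>k\<ge>N. E (\<lambda>x. g n x - g k x) (\<lambda>x. g n x - g k x) < \<epsilon>" by blast
  qed
  moreover have "(\<lambda>n. \<integral>x. (g n x - v x)\<^sup>2 \<partial>M) \<longlonglongrightarrow> 0"
    by (rule tendsto_sandwich[OF _ _ tendsto_const r0]) (use gv in auto)
  ultimately have "approx_seq E D M g v" using gD by (simp add: approx_seq_def)
  moreover have "(\<lambda>n. E (g n) (g n)) \<longlonglongrightarrow> L"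
  proof (rule tendsto_sandwich[OF _ _ L(1)])
    show "(\<lambda>n. d n + r n) \<longlonglongrightarrow> L" using tendsto_add[OF L(1) r0] by simp
    show "\<forall>\<^sub>F n in sequentially. d n \<le> E (g n) (g n)" using d_le g(1) by simp
    show "\<forall>\<^sub>F n in sequentially. E (g n) (g n) \<le> d n + r n" using g(2) by (simp add: less_imp_le)
  qed
  moreover have "L \<le> l" using LIMSEQ_le_const2[OF L(1)] d_l by blast
  ultimately show ?thesis using limI by blast
qed

text \<open>The functions F \<circ> f n tend to F \<circ> u in L2 with energies at most those of f
  n, but they need not be \<open>E_Cauchy\<close>. The preceding lemma exchanges them for an
  \<open>E_Cauchy\<close> sequence with the same limit and no larger limiting energy.\<close>

lemma closure_Markov:
  assumes u: "sq_integrable u" and f: "approx_seq E D M f u" and F: "normal_contraction F"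
  shows "\<exists>g. approx_seq E D M g (F \<circ> u) \<and> lim (\<lambda>n. E (g n) (g n)) \<le> lim (\<lambda>n. E (f n) (f n))"
proof (rule approx_seq_of_bounded_energy)
  have fD: "f n \<in> D" for n using f by (simp add: approx_seq_def)
  have F0: "F 0 = 0" and FL: "\<bar>F a - F b\<bar> \<le> \<bar>a - b\<bar>" for a b
    using F by (auto simp: normal_contraction_def)
  have "continuous_on UNIV F"
    using FL by (intro lipschitz_on_continuous_on[of 1] lipschitz_onI) (auto simp: dist_real_def)
  hence [measurable]: "F \<in> borel_measurable borel" by (rule borel_measurable_continuous_onI)
  have [measurable]: "u \<in> borel_measurable M" using u by (simp add: sq_integrable_def)
  have Fu: "sq_integrable (F \<circ> u)"
    by (rule sq_integrable_bound[OF _ u, of _ 1]) (use FL[of _ 0] F0 in \<open>auto simp: comp_def\<close>)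
  thus "sq_integrable (F \<circ> u)" .
  show FD: "(\<lambda>x. F (f k x)) \<in> D" for k using fD F by (rule D_comp)
  show "E (\<lambda>x. F (f k x)) (\<lambda>x. F (f k x)) \<le> E (f k) (f k)" for k using fD F by (rule E_comp_le)
  show "(\<lambda>n. E (f n) (f n)) \<longlonglongrightarrow> lim (\<lambda>n. E (f n) (f n))"
    using E_Cauchy_convergent[of f, OF fD] f by (simp add: approx_seq_def convergent_LIMSEQ_iff)
  have le: "(\<integral>x. (F (f k x) - (F \<circ> u) x)\<^sup>2 \<partial>M) \<le> (\<integral>x. (f k x - u x)\<^sup>2 \<partial>M)" for k
    using FL by (intro integral_sq_mono sq_integrable_diff sq_integrable_D[OF FD] sq_integrable_D[OF fD] u Fu) auto
  have lim: "(\<lambda>k. \<integral>x. (f k x - u x)\<^sup>2 \<partial>M) \<longlonglongrightarrow> 0" using f by (simp add: approx_seq_def)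
  show "(\<lambda>k. \<integral>x. (F (f k x) - (F \<circ> u) x)\<^sup>2 \<partial>M) \<longlonglongrightarrow> 0"
    by (rule tendsto_sandwich[OF _ _ tendsto_const lim]) (use le in auto)
qed

section \<open>Density of the domain in L2\<close>

lemma S_Int: "A \<in> S_sets D \<Longrightarrow> B \<in> S_sets D \<Longrightarrow> A \<inter> B \<in> S_sets D"
proof -
  assume "A \<in> S_sets D" "B \<in> S_sets D"
  then obtain f g where "f \<in> D" "g \<in> D" "A = {x. f x > 0}" "B = {x. g x > 0}"
    by (auto simp: S_sets_def)
  thus ?thesis using positive_set_S[of "\<lambda>x. min (f x) (g x)"] by (simp add: Collect_conj_eq)
qed

lemma S_Un: "A \<in> S_sets D \<Longrightarrow> B \<in> S_sets D \<Longrightarrow> A \<union> B \<in> S_sets D"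
proof -
  assume "A \<in> S_sets D" "B \<in> S_sets D"
  then obtain f g where "f \<in> D" "g \<in> D" "A = {x. f x > 0}" "B = {x. g x > 0}"
    by (auto simp: S_sets_def)
  thus ?thesis
    using positive_set_S[of "\<lambda>x. max (f x) (g x)"] by (simp add: Collect_disj_eq less_max_iff_disj)
qed

text \<open>Through (f - a)^+ the family \<open>S_sets D\<close> contains {f > a} for a \<ge> 0. For
  a < 0, where constants would be wanted, {f > a} is the union of the sets {-f \<le> c n} with 0
  \<le> c n < -a and c n \<rightarrow> -a. The result gives the sigma-algebra an intersection-stable
  generator.\<close>

lemma sets_eq_sigma_S: "Sigma_Algebra.sets M = sigma_sets UNIV (S_sets D)"
proof
  show "sigma_sets UNIV (S_sets D) \<subseteq> Sigma_Algebra.sets M"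
    using S_subset_sets sets.sigma_sets_subset[of "S_sets D" M] by (auto simp: space)
  define N where "N = sigma UNIV (S_sets D)"
  have N: "Sigma_Algebra.space N = UNIV" "Sigma_Algebra.sets N = sigma_sets UNIV (S_sets D)"
    by (simp_all add: N_def)
  have pos: "{x. f x > a} \<in> Sigma_Algebra.sets N" if "f \<in> D" "a \<ge> 0" for f a
  proof -
    have "{x. f x > a} = {x. max (f x - a) 0 > 0}" by (auto simp: less_max_iff_disj)
    thus ?thesis using positive_set_S[of "\<lambda>x. max (f x - a) 0"] that by (simp add: N sigma_sets.Basic)
  qed
  have meas: "f \<in> borel_measurable N" if f: "f \<in> D" for f
    unfolding borel_measurable_iff_greater
  proof
    fix a
    show "{x \<in> Sigma_Algebra.space N. a < f x} \<in> Sigma_Algebra.sets N"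
    proof (cases "a \<ge> 0")
      case True thus ?thesis using pos[OF f] by (simp add: N)
    next
      case False
      define c where "c n = - a - (- a) * inverse (real (Suc n))" for n
      have c_less: "c n < - a" for n using False by (simp add: c_def mult_neg_pos)
      have c_ge: "\<exists>n. b \<le> c n" if "b < - a" for b
      proof -
        have "c \<longlonglongrightarrow> - a - (- a) * 0"
          unfolding c_def by (intro tendsto_intros LIMSEQ_inverse_real_of_nat)
        from order_tendstoD(1)[OF this, of b] that show ?thesis
          by (auto simp: eventually_sequentially intro: less_imp_le)
      qed
      have "{x. a < f x} = (\<Union>n. - {x. - f x > c n})"
      proof (intro equalityI subsetI)
        fix x assume "x \<in> {x. a < f x}"
        thus "x \<in> (\<Union>n. - {x. - f x > c n})" using c_ge[of "- f x"] by (auto simp: not_less)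
      next
        fix x assume "x \<in> (\<Union>n. - {x. - f x > c n})"
        then obtain n where "- f x \<le> c n" by (auto simp: not_less)
        thus "x \<in> {x. a < f x}" using c_less[of n] by simp
      qed
      moreover have "- {x. - f x > c n} \<in> Sigma_Algebra.sets N" for n
      proof -
        have "inverse (real (Suc n)) \<le> 1" by (simp add: inverse_le_1_iff)
        hence "(- a) * inverse (real (Suc n)) \<le> (- a) * 1" using False by (intro mult_left_mono) auto
        hence "c n \<ge> 0" by (simp add: c_def)
        from sets.compl_sets[OF pos[of "\<lambda>x. - f x", OF _ this]] f show ?thesis
          by (simp add: N Compl_eq_Diff_UNIV)
      qed
      ultimately show ?thesis by (auto simp: N(1) intro!: sets.countable_UN)
    qed
  qed
  have "f -` B \<in> Sigma_Algebra.sets N" if "f \<in> D" "B \<in> Sigma_Algebra.sets borel" for f B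
    using measurable_sets[OF meas[OF that(1)] that(2)] by (simp add: N)
  thus "Sigma_Algebra.sets M \<subseteq> sigma_sets UNIV (S_sets D)"
    unfolding sets sigma_D_def using sets.sigma_sets_subset[of "{f -` B |f B. f \<in> D \<and> B \<in> Sigma_Algebra.sets borel}" N]
    by (auto simp: N)
qed

text \<open>The approximants stay below the indicator, so they are competitors in
  \<open>energy_S\<close>; a general L2 approximation would not give this.\<close>

lemma S_indicator_approx:
  assumes "A \<in> S_sets D"
  obtains h where "\<And>n::nat. h n \<in> D" "\<And>n x. 0 \<le> h n x" "\<And>n x. h n x \<le> indicator A x"
    "(\<lambda>n. \<integral>x. (h n x - indicator A x)\<^sup>2 \<partial>M) \<longlonglongrightarrow> 0"
proof -
  obtain f where f: "f \<in> D" "A = {x. f x > 0}" using assms by (auto simp: S_sets_def)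
  define h where "h n = (\<lambda>x. min (real n * max (f x) 0) 1)" for n
  have hD: "h n \<in> D" for n
    unfolding h_def using f by (intro D_min_const D_scale D_max D_zero) auto
  have h0: "0 \<le> h n x" for n x by (simp add: h_def)
  have h1: "h n x \<le> indicator A x" for n x by (auto simp: h_def f(2) split: split_indicator)
  have lim: "(\<lambda>n. h n x) \<longlonglongrightarrow> indicator A x" for x
  proof (cases "x \<in> A")
    case True
    hence fx: "f x > 0" by (simp add: f)
    obtain N :: nat where N: "real N > 1 / f x" using reals_Archimedean2 by blast
    have "h n x = 1" if "n \<ge> N" for n
    proof -
      have "1 / f x \<le> real n" using N that by linarith
      thus ?thesis using fx by (simp add: h_def field_simps)
    qed
    hence "eventually (\<lambda>n. h n x = indicator A x) sequentially"
      using True by (auto simp: eventually_sequentially)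
    thus ?thesis by (rule tendsto_eventually)
  next
    case False
    hence "h n x = 0" for n by (simp add: h_def f)
    thus ?thesis using False by simp
  qed
  have "(\<lambda>n. \<integral>x. (h n x - indicator A x)\<^sup>2 \<partial>M) \<longlonglongrightarrow> 0"
  proof (rule integral_sq_tendsto_0[where w="\<lambda>x. 1"])
    show "\<bar>h n x - indicator A x\<bar> \<le> 1" for n x
      using h0[of n x] h1[of n x] indicator_le_1[of A x] by (auto simp: abs_le_iff split: split_indicator_asm split_indicator)
    show "sq_integrable (\<lambda>x. 1)" by (simp add: sq_integrable_def)
    show "(indicator A :: 'a \<Rightarrow> real) \<in> borel_measurable M" using S_subset_sets[OF assms] by simp
  qed (use lim D_measurable[OF hD] in auto)
  thus ?thesis using that hD h0 h1 by blast
qed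

definition L2_approximable :: "('a \<Rightarrow> real) \<Rightarrow> bool" where
  "L2_approximable u \<longleftrightarrow> sq_integrable u \<and> (\<forall>\<epsilon>>0. \<exists>h\<in>D. (\<integral>x. (h x - u x)\<^sup>2 \<partial>M) < \<epsilon>)"

lemma L2_approximable_limit:
  assumes u: "sq_integrable u" and w: "\<And>n::nat. L2_approximable (w n)"
    and lim: "(\<lambda>n. \<integral>x. (w n x - u x)\<^sup>2 \<partial>M) \<longlonglongrightarrow> 0"
  shows "L2_approximable u"
  unfolding L2_approximable_def
proof (intro conjI allI impI u)
  fix \<epsilon> :: real assume \<epsilon>: "\<epsilon> > 0"
  then obtain n where n: "(\<integral>x. (w n x - u x)\<^sup>2 \<partial>M) < \<epsilon> / 4"
    using eventually_happens'[OF _ order_tendstoD(2)[OF lim, of "\<epsilon> / 4"]] by auto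
  obtain h where h: "h \<in> D" "(\<integral>x. (h x - w n x)\<^sup>2 \<partial>M) < \<epsilon> / 4"
    using w[of n] \<epsilon> unfolding L2_approximable_def by (meson divide_pos_pos zero_less_numeral)
  have "(\<integral>x. (h x - u x)\<^sup>2 \<partial>M) \<le> 2 * ((\<integral>x. (h x - w n x)\<^sup>2 \<partial>M) + (\<integral>x. (w n x - u x)\<^sup>2 \<partial>M))"
    using w[of n] u by (intro integral_sq_triangle sq_integrable_D[OF h(1)]) (auto simp: L2_approximable_def)
  thus "\<exists>h\<in>D. (\<integral>x. (h x - u x)\<^sup>2 \<partial>M) < \<epsilon>" using h n by (intro bexI[of _ h]) auto
qed

lemma L2_approximable_D: "h \<in> D \<Longrightarrow> L2_approximable h"
  unfolding L2_approximable_def by (auto intro!: bexI[of _ h] sq_integrable_D)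

lemma L2_approximable_add:
  assumes u: "L2_approximable u" and v: "L2_approximable v"
  shows "L2_approximable (\<lambda>x. u x + v x)"
  unfolding L2_approximable_def
proof (intro conjI allI impI)
  have uv: "sq_integrable u" "sq_integrable v" using u v by (auto simp: L2_approximable_def)
  thus "sq_integrable (\<lambda>x. u x + v x)" by (rule sq_integrable_add)
  fix \<epsilon> :: real assume \<epsilon>: "\<epsilon> > 0"
  obtain h where h: "h \<in> D" "(\<integral>x. (h x - u x)\<^sup>2 \<partial>M) < \<epsilon> / 4"
    using u \<epsilon> unfolding L2_approximable_def by (meson divide_pos_pos zero_less_numeral)
  obtain k where k: "k \<in> D" "(\<integral>x. (k x - v x)\<^sup>2 \<partial>M) < \<epsilon> / 4"
    using v \<epsilon> unfolding L2_approximable_def by (meson divide_pos_pos zero_less_numeral)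
  have "(\<integral>x. ((h x + k x) - (u x + v x))\<^sup>2 \<partial>M) = (\<integral>x. ((h x - u x) + (k x - v x))\<^sup>2 \<partial>M)"
    by (simp add: algebra_simps)
  also have "\<dots> \<le> 2 * ((\<integral>x. (h x - u x)\<^sup>2 \<partial>M) + (\<integral>x. (k x - v x)\<^sup>2 \<partial>M))"
    using uv by (intro integral_sq_add_le sq_integrable_diff sq_integrable_D[OF h(1)] sq_integrable_D[OF k(1)])
  also have "\<dots> < \<epsilon>" using h k by simp
  finally show "\<exists>h\<in>D. (\<integral>x. (h x - (u x + v x))\<^sup>2 \<partial>M) < \<epsilon>"
    using h k by (intro bexI[of _ "\<lambda>x. h x + k x"]) auto
qed

lemma L2_approximable_scale:
  assumes u: "L2_approximable u" shows "L2_approximable (\<lambda>x. c * u x)"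
proof (cases "c = 0")
  case True thus ?thesis using L2_approximable_D[OF D_zero] by simp
next
  case False
  show ?thesis unfolding L2_approximable_def
  proof (intro conjI allI impI)
    show "sq_integrable (\<lambda>x. c * u x)" using u by (simp add: L2_approximable_def sq_integrable_scale)
    fix \<epsilon> :: real assume \<epsilon>: "\<epsilon> > 0"
    have "\<epsilon> / c\<^sup>2 > 0" using \<epsilon> False by simp
    then obtain h where h: "h \<in> D" "(\<integral>x. (h x - u x)\<^sup>2 \<partial>M) < \<epsilon> / c\<^sup>2"
      using u unfolding L2_approximable_def by blast
    have "(\<integral>x. (c * h x - c * u x)\<^sup>2 \<partial>M) = (\<integral>x. c\<^sup>2 * (h x - u x)\<^sup>2 \<partial>M)"
      by (simp add: power_mult_distrib flip: right_diff_distrib)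
    also have "\<dots> < \<epsilon>" using h False by (simp add: field_simps)
    finally show "\<exists>h\<in>D. (\<integral>x. (h x - c * u x)\<^sup>2 \<partial>M) < \<epsilon>"
      using h by (intro bexI[of _ "\<lambda>x. c * h x"]) auto
  qed
qed

lemma L2_approximable_sum:
  assumes "finite I" "\<And>i. i \<in> I \<Longrightarrow> L2_approximable (u i)"
  shows "L2_approximable (\<lambda>x. \<Sum>i\<in>I. u i x)"
  using assms by (induction I rule: finite_induct) (auto intro: L2_approximable_add L2_approximable_D)

text \<open>Dynkin's argument: the L2 closure of \<open>D\<close> is a vector space containing the
  constant 1, because UNIV is in \<open>S_sets D\<close>. This settles complements; for disjoint
  unions the partial sums converge in L2 by dominated convergence, as \<open>M\<close> is
  finite.\<close>

lemma L2_approximable_indicator: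
  assumes "A \<in> Sigma_Algebra.sets M"
  shows "L2_approximable (indicator A)"
proof -
  have "Int_stable (S_sets D)" by (auto simp: Int_stable_def S_Int)
  moreover have "S_sets D \<subseteq> Pow UNIV" by simp
  moreover have "A \<in> sigma_sets UNIV (S_sets D)" using assms by (simp add: sets_eq_sigma_S)
  ultimately show ?thesis
  proof (induction rule: sigma_sets_induct_disjoint)
    case (basic A)
    show ?case by (rule S_indicator_approx[OF basic])
      (use S_subset_sets[OF basic] L2_approximable_D in \<open>blast intro: L2_approximable_limit sq_integrable_indicator\<close>)
  next
    case empty
    show ?case using L2_approximable_D[OF D_zero] by (simp add: indicator_def[abs_def])
  next
    case (compl A)
    have "L2_approximable (indicator UNIV)" 
      by (rule S_indicator_approx[OF UNIV_in_S])
      (use S_subset_sets[OF UNIV_in_S] L2_approximable_D in \<open>blast intro: L2_approximable_limit sq_integrable_indicator\<close>)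
    from L2_approximable_add[OF this L2_approximable_scale[OF compl(2), of "-1"]]
    have "L2_approximable (\<lambda>x. indicator UNIV x + - 1 * indicator A x)" .
    also have "(\<lambda>x. indicator UNIV x + - 1 * indicator A x) = (indicator (UNIV - A) :: 'a \<Rightarrow> real)"
      by (auto split: split_indicator)
    finally show ?case .
  next
    case (union A)
    have A: "A i \<in> Sigma_Algebra.sets M" for i using union(2) by (auto simp: sets_eq_sigma_S)
    define w where "w n = (\<lambda>x. \<Sum>i<n. indicator (A i) x :: real)" for n
    have dense: "L2_approximable (w n)" for n
      unfolding w_def using union(3) by (intro L2_approximable_sum) auto
    have weq: "w n = indicator (\<Union>i<n. A i)" for n
    proof
      fix x
      have "disjoint_family_on A {..<n}" using union(1) by (auto simp: disjoint_family_on_def)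
      thus "w n x = indicator (\<Union>i<n. A i) x"
        unfolding w_def by (intro indicator_UN_disjoint[symmetric]) auto
    qed
    have "(\<lambda>n. \<integral>x. (w n x - indicator (\<Union>i. A i) x)\<^sup>2 \<partial>M) \<longlonglongrightarrow> 0"
    proof (rule integral_sq_tendsto_0[where w="\<lambda>x. 1"])
      show "w n \<in> borel_measurable M" for n using dense by (simp add: L2_approximable_def sq_integrable_def)
      show "(indicator (\<Union>i. A i) :: 'a \<Rightarrow> real) \<in> borel_measurable M"
        using A by (intro borel_measurable_indicator) auto
      show "sq_integrable (\<lambda>x. 1)" by (simp add: sq_integrable_def)
      show "\<bar>w n x - indicator (\<Union>i. A i) x\<bar> \<le> 1" for n x
        unfolding weq by (auto split: split_indicator)
      show "(\<lambda>n. w n x) \<longlonglongrightarrow> indicator (\<Union>i. A i) x" for x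
        unfolding weq by (rule LIMSEQ_indicator_UN)
    qed
    thus ?case using dense A by (intro L2_approximable_limit[OF sq_integrable_indicator]) auto
  qed
qed

lemma L2_approximable_all:
  assumes u: "sq_integrable u" shows "L2_approximable u"
proof -
  have um: "u \<in> borel_measurable M" using u by (simp add: sq_integrable_def)
  obtain F where F: "\<And>i::nat. simple_function M (F i)" "\<And>x. (\<lambda>i. F i x) \<longlonglongrightarrow> u x"
    "\<And>i x. \<bar>F i x\<bar> \<le> 2 * \<bar>u x\<bar>"
    using borel_measurable_implies_sequence_metric[OF um, of 0] by (auto simp: space)
  have dense: "L2_approximable (F i)" for i
  proof -
    have "F i = (\<lambda>x. \<Sum>y\<in>F i ` UNIV. y * indicator (F i -` {y}) x)"
    proof
      fix x
      have "(\<Sum>y\<in>F i ` UNIV. y * indicator (F i -` {y}) x) = (\<Sum>y\<in>{F i x}. y * indicator (F i -` {y}) x)"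
        using simple_functionD(1)[OF F(1)[of i]] by (intro sum.mono_neutral_right) (auto simp: space indicator_def)
      thus "F i x = (\<Sum>y\<in>F i ` UNIV. y * indicator (F i -` {y}) x)" by simp
    qed
    moreover have "L2_approximable (\<lambda>x. \<Sum>y\<in>F i ` UNIV. y * indicator (F i -` {y}) x)"
      using simple_functionD[OF F(1)[of i]] by (intro L2_approximable_sum L2_approximable_scale L2_approximable_indicator) (auto simp: space)
    ultimately show ?thesis by simp
  qed
  have "(\<lambda>i. \<integral>x. (F i x - u x)\<^sup>2 \<partial>M) \<longlonglongrightarrow> 0"
  proof (rule integral_sq_tendsto_0[where w="\<lambda>x. 3 * \<bar>u x\<bar>"])
    show "F i \<in> borel_measurable M" for i using F(1) by (rule borel_measurable_simple_function)
    show "sq_integrable (\<lambda>x. 3 * \<bar>u x\<bar>)"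
      by (rule sq_integrable_bound[OF _ u, of _ 3]) (use um in auto)
    show "\<bar>F i x - u x\<bar> \<le> 3 * \<bar>u x\<bar>" for i x using F(3)[of i x] by linarith
  qed (use F um in auto)
  thus ?thesis using L2_approximable_limit[of u F] u dense by blast
qed

lemma closure_Dirichlet: "closure_is_Dirichlet E D M"
  unfolding closure_is_Dirichlet_def
proof (intro conjI allI impI)
  fix u :: "'a \<Rightarrow> real" assume "u \<in> borel_measurable M \<and> integrable M (\<lambda>x. (u x)\<^sup>2)"
  hence "L2_approximable u" by (intro L2_approximable_all) (simp add: sq_integrable_def)
  hence "\<forall>n. \<exists>h\<in>D. (\<integral>x. (h x - u x)\<^sup>2 \<partial>M) < inverse (real (Suc n))"
    by (simp add: L2_approximable_def)
  then obtain f where f: "\<And>n. f n \<in> D" "\<And>n. (\<integral>x. (f n x - u x)\<^sup>2 \<partial>M) < inverse (real (Suc n))"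
    by metis
  have "(\<lambda>n. \<integral>x. (f n x - u x)\<^sup>2 \<partial>M) \<longlonglongrightarrow> 0"
    by (rule tendsto_sandwich[OF _ _ tendsto_const LIMSEQ_inverse_real_of_nat])
      (use f(2) in \<open>auto intro!: always_eventually simp: less_imp_le\<close>)
  thus "\<exists>f. (\<forall>n. f n \<in> D) \<and> (\<lambda>n. \<integral>x. (f n x - u x)\<^sup>2 \<partial>M) \<longlonglongrightarrow> 0" using f(1) by blast
qed (use closure_Markov in \<open>auto simp: sq_integrable_def\<close>)

section \<open>The energy measure and its density\<close>


lemma integral_sq_indicator:
  "A \<in> Sigma_Algebra.sets M \<Longrightarrow> (\<integral>x. (indicator A x :: real)\<^sup>2 \<partial>M) = measure M A"
proof -
  have "(\<lambda>x. (indicator A x :: real)\<^sup>2) = indicator A" by (auto split: split_indicator)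
  thus ?thesis by (simp add: space)
qed

definition unit_approx :: "'a set \<Rightarrow> (nat \<Rightarrow> 'a \<Rightarrow> real) \<Rightarrow> bool" where
  "unit_approx A h \<longleftrightarrow> (\<forall>k. h k \<in> D) \<and> (\<forall>k x. 0 \<le> h k x \<and> h k x \<le> 1) \<and>
     (\<lambda>k. \<integral>x. (h k x - indicator A x)\<^sup>2 \<partial>M) \<longlonglongrightarrow> 0"

text \<open>Clipping to [0, 1] does not increase the distance to an indicator. The bound is wanted
  since the \<delta> of \<open>L_fun_small\<close> depends on a sup bound.\<close>

lemma unit_approximable:
  assumes A: "A \<in> Sigma_Algebra.sets M" and \<epsilon>: "\<epsilon> > 0"
  shows "\<exists>h\<in>D. (\<forall>x. 0 \<le> h x \<and> h x \<le> 1) \<and> (\<integral>x. (h x - indicator A x)\<^sup>2 \<partial>M) < \<epsilon>"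
proof -
  obtain h where h: "h \<in> D" "(\<integral>x. (h x - indicator A x)\<^sup>2 \<partial>M) < \<epsilon>"
    using L2_approximable_indicator[OF A] \<epsilon> unfolding L2_approximable_def by blast
  define g where "g = (\<lambda>x. min (max (h x) 0) 1)"
  have g: "g \<in> D" using h by (simp add: g_def)
  have ind: "sq_integrable (indicator A)" using A by (rule sq_integrable_indicator)
  have "(\<integral>x. (g x - indicator A x)\<^sup>2 \<partial>M) \<le> (\<integral>x. (h x - indicator A x)\<^sup>2 \<partial>M)"
    by (intro integral_sq_mono sq_integrable_diff[OF _ ind] sq_integrable_D[OF g] sq_integrable_D[OF h(1)])
      (auto simp: g_def split: split_indicator)
  thus ?thesis using g h by (intro bexI[of _ g]) (auto simp: g_def)
qed

lemma unit_approx_exists: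
  assumes "A \<in> Sigma_Algebra.sets M" shows "\<exists>h. unit_approx A h"
proof -
  have "\<exists>h\<in>D. (\<forall>x. 0 \<le> h x \<and> h x \<le> 1) \<and> (\<integral>x. (h x - indicator A x)\<^sup>2 \<partial>M) < inverse (real (Suc n))" for n
    by (rule unit_approximable[OF assms]) simp
  then obtain h where h: "\<And>n. h n \<in> D" "\<And>n x. 0 \<le> h n x \<and> h n x \<le> 1"
    "\<And>n. (\<integral>x. (h n x - indicator A x)\<^sup>2 \<partial>M) < inverse (real (Suc n))" by metis
  have "(\<lambda>n. \<integral>x. (h n x - indicator A x)\<^sup>2 \<partial>M) \<longlonglongrightarrow> 0"
    by (rule tendsto_sandwich[OF _ _ tendsto_const LIMSEQ_inverse_real_of_nat])
      (use h(3) in \<open>auto intro!: always_eventually simp: less_imp_le\<close>)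
  thus ?thesis using h unfolding unit_approx_def by blast
qed

text \<open>The extension of \<open>L_fun E f\<close> from \<open>D\<close> to indicators of measurable sets, by \<open>L\<^sub>2\<close>-density
  of \<open>D\<close>; it is only meaningful on \<open>sets M\<close>.\<close>

definition energy :: "('a \<Rightarrow> real) \<Rightarrow> 'a set \<Rightarrow> real" where
  "energy f A = lim (\<lambda>k. L_fun E f ((SOME h. unit_approx A h) k))"

text \<open>Applied to differences, \<open>L_fun_small\<close> shows that the values of L_f converge
  along the chosen sequence, and that any other bounded sequence with the same L2 limit gives the
  same value. So the choice in \<open>energy\<close> is immaterial, and later proofs may pick
  convenient approximants.\<close>

lemma L_fun_tendsto_energy:
  assumes f: "f \<in> D" and A: "A \<in> Sigma_Algebra.sets M"
    and h: "\<And>k::nat. h k \<in> D" "\<And>k x. \<bar>h k x\<bar> \<le> C"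
    and lim: "(\<lambda>k. \<integral>x. (h k x - indicator A x)\<^sup>2 \<partial>M) \<longlonglongrightarrow> 0"
  shows "(\<lambda>k. L_fun E f (h k)) \<longlonglongrightarrow> energy f A"
proof -
  define a where "a = (SOME h. unit_approx A h)"
  have "unit_approx A a" unfolding a_def by (rule someI_ex[OF unit_approx_exists[OF A]])
  hence a: "a k \<in> D" "0 \<le> a k x" "a k x \<le> 1" "(\<lambda>k. \<integral>x. (a k x - indicator A x)\<^sup>2 \<partial>M) \<longlonglongrightarrow> 0" for k x
    by (auto simp: unit_approx_def)
  have ind: "sq_integrable (indicator A)" using A by (rule sq_integrable_indicator)
  have tri: "(\<integral>x. (g x - k x)\<^sup>2 \<partial>M) \<le> 2 * ((\<integral>x. (g x - indicator A x)\<^sup>2 \<partial>M) + (\<integral>x. (k x - indicator A x)\<^sup>2 \<partial>M))"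
    if "g \<in> D" "k \<in> D" for g k
    using integral_sq_triangle[OF sq_integrable_D[OF that(1)] ind sq_integrable_D[OF that(2)]]
    by (simp add: power2_commute)
  have "Cauchy (\<lambda>k. L_fun E f (a k))"
  proof (rule CauchyI)
    fix \<epsilon> :: real assume \<epsilon>: "\<epsilon> > 0"
    obtain d where d: "d > 0" "\<forall>h\<in>D. (\<forall>x. \<bar>h x\<bar> \<le> 1) \<longrightarrow> (\<integral>x. (h x)\<^sup>2 \<partial>M) < d \<longrightarrow> \<bar>L_fun E f h\<bar> < \<epsilon>"
      using L_fun_small[OF f zero_less_one \<epsilon>] by blast
    obtain N where N: "\<And>k. k \<ge> N \<Longrightarrow> (\<integral>x. (a k x - indicator A x)\<^sup>2 \<partial>M) < d / 4"
      using order_tendstoD(2)[OF a(4), of "d / 4"] d(1) by (auto simp: eventually_sequentially)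
    have "norm (L_fun E f (a m) - L_fun E f (a n)) < \<epsilon>" if "m \<ge> N" "n \<ge> N" for m n
    proof -
      have "(\<integral>x. (a m x - a n x)\<^sup>2 \<partial>M) < d"
        using tri[OF a(1)[of m] a(1)[of n]] N[OF that(1)] N[OF that(2)] by argo
      moreover have "\<bar>a m x - a n x\<bar> \<le> 1" for x
        using a(2,3)[of m x] a(2,3)[of n x] by (simp add: abs_le_iff)
      ultimately have "\<bar>L_fun E f (\<lambda>x. a m x - a n x)\<bar> < \<epsilon>" using d(2) a(1) by simp
      thus ?thesis using L_fun_diff_arg[OF f a(1) a(1), of m n] by simp
    qed
    thus "\<exists>N. \<forall>m\<ge>N. \<forall>n\<ge>N. norm (L_fun E f (a m) - L_fun E f (a n)) < \<epsilon>" by blast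
  qed
  hence "(\<lambda>k. L_fun E f (a k)) \<longlonglongrightarrow> energy f A"
    unfolding energy_def a_def[symmetric] using real_Cauchy_convergent convergent_LIMSEQ_iff by blast
  moreover have "(\<lambda>k. L_fun E f (\<lambda>x. h k x - a k x)) \<longlonglongrightarrow> 0"
  proof (rule L_fun_tendsto_0[OF f, where C = "C + 1"])
    show "\<bar>h k x - a k x\<bar> \<le> C + 1" for k x using h(2)[of k x] a(2,3)[of k x] by linarith
    have "(\<lambda>k. 2 * ((\<integral>x. (h k x - indicator A x)\<^sup>2 \<partial>M) + (\<integral>x. (a k x - indicator A x)\<^sup>2 \<partial>M)))
        \<longlonglongrightarrow> 2 * (0 + 0)"
      by (intro tendsto_intros lim a(4))
    hence lim2: "(\<lambda>k. 2 * ((\<integral>x. (h k x - indicator A x)\<^sup>2 \<partial>M) + (\<integral>x. (a k x - indicator A x)\<^sup>2 \<partial>M))) \<longlonglongrightarrow> 0"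
      by simp
    show "(\<lambda>k. \<integral>x. (h k x - a k x)\<^sup>2 \<partial>M) \<longlonglongrightarrow> 0"
      by (rule tendsto_sandwich[OF _ _ tendsto_const lim2]) (use tri[OF h(1) a(1)] in auto)
  qed (use h a in simp)
  ultimately have "(\<lambda>k. L_fun E f (\<lambda>x. h k x - a k x) + L_fun E f (a k)) \<longlonglongrightarrow> 0 + energy f A"
    by (intro tendsto_add)
  thus ?thesis using L_fun_diff_arg[OF f h(1) a(1)] by simp
qed

lemma unit_approx_tendsto_energy:
  assumes "f \<in> D" "A \<in> Sigma_Algebra.sets M" "unit_approx A h"
  shows "(\<lambda>k. L_fun E f (h k)) \<longlonglongrightarrow> energy f A"
  using assms by (intro L_fun_tendsto_energy[where C=1]) (auto simp: unit_approx_def)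

lemma energy_nonneg:
  assumes f: "f \<in> D" and A: "A \<in> Sigma_Algebra.sets M" shows "0 \<le> energy f A"
proof -
  obtain h where h: "unit_approx A h" using unit_approx_exists[OF A] by blast
  have "0 \<le> L_fun E f (h k)" for k using h f by (intro L_fun_nonneg) (auto simp: unit_approx_def)
  thus ?thesis using LIMSEQ_le_const[OF unit_approx_tendsto_energy[OF f A h]] by blast
qed

lemma energy_Un:
  assumes f: "f \<in> D" and A: "A \<in> Sigma_Algebra.sets M" and B: "B \<in> Sigma_Algebra.sets M"
    and disj: "A \<inter> B = {}"
  shows "energy f (A \<union> B) = energy f A + energy f B"
proof -
  obtain a where a: "unit_approx A a" using unit_approx_exists[OF A] by blast
  obtain b where b: "unit_approx B b" using unit_approx_exists[OF B] by blast
  have ab: "a k \<in> D" "b k \<in> D" "0 \<le> a k x" "0 \<le> b k x" "a k x \<le> 1" "b k x \<le> 1" for k x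
    using a b by (auto simp: unit_approx_def)
  have ind: "sq_integrable (indicator A)" "sq_integrable (indicator B)"
    using A B by (auto intro: sq_integrable_indicator)
  have "(\<lambda>k. L_fun E f (\<lambda>x. a k x + b k x)) \<longlonglongrightarrow> energy f (A \<union> B)"
  proof (rule L_fun_tendsto_energy[OF f, where C=2])
    show "\<bar>a k x + b k x\<bar> \<le> 2" for k x using ab(3,5)[of k x] ab(4,6)[of k x] by simp
    have eq: "(a k x + b k x) - indicator (A \<union> B) x = (a k x - indicator A x) + (b k x - indicator B x)" for k x
      using disj by (auto split: split_indicator)
    have le: "(\<integral>x. ((a k x + b k x) - indicator (A \<union> B) x)\<^sup>2 \<partial>M)
      \<le> 2 * ((\<integral>x. (a k x - indicator A x)\<^sup>2 \<partial>M) + (\<integral>x. (b k x - indicator B x)\<^sup>2 \<partial>M))" for k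
      unfolding eq
      by (intro integral_sq_add_le sq_integrable_diff ind sq_integrable_D[OF ab(1)] sq_integrable_D[OF ab(2)])
    have "(\<lambda>k. 2 * ((\<integral>x. (a k x - indicator A x)\<^sup>2 \<partial>M) + (\<integral>x. (b k x - indicator B x)\<^sup>2 \<partial>M))) \<longlonglongrightarrow> 2 * (0 + 0)"
      using a b by (intro tendsto_intros) (auto simp: unit_approx_def)
    hence lim: "(\<lambda>k. 2 * ((\<integral>x. (a k x - indicator A x)\<^sup>2 \<partial>M) + (\<integral>x. (b k x - indicator B x)\<^sup>2 \<partial>M))) \<longlonglongrightarrow> 0"
      by simp
    show "(\<lambda>k. \<integral>x. (a k x + b k x - indicator (A \<union> B) x)\<^sup>2 \<partial>M) \<longlonglongrightarrow> 0"
      by (rule tendsto_sandwich[OF _ _ tendsto_const lim]) (use le in auto)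
  qed (use ab A B in auto)
  moreover have "(\<lambda>k. L_fun E f (\<lambda>x. a k x + b k x)) \<longlonglongrightarrow> energy f A + energy f B"
    using tendsto_add[OF unit_approx_tendsto_energy[OF f A a] unit_approx_tendsto_energy[OF f B b]]
      L_fun_plus_arg[OF f ab(1,2)] by simp
  ultimately show ?thesis by (rule LIMSEQ_unique)
qed

lemma energy_split:
  assumes "f \<in> D" "A \<in> Sigma_Algebra.sets M" "B \<in> Sigma_Algebra.sets M" "A \<subseteq> B"
  shows "energy f B = energy f A + energy f (B - A)"
  using energy_Un[of f A "B - A"] assms by (simp add: Un_absorb1)

lemma energy_mono:
  assumes "f \<in> D" "A \<in> Sigma_Algebra.sets M" "B \<in> Sigma_Algebra.sets M" "A \<subseteq> B"
  shows "energy f A \<le> energy f B"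
  using energy_split[OF assms] energy_nonneg[of f "B - A"] assms by simp

lemma energy_subadditive:
  assumes f: "f \<in> D" and A: "A \<in> Sigma_Algebra.sets M" and B: "B \<in> Sigma_Algebra.sets M"
  shows "energy f (A \<union> B) \<le> energy f A + energy f B"
proof -
  have "energy f (A \<union> (B - A)) = energy f A + energy f (B - A)"
    using A B by (intro energy_Un f) auto
  moreover have "energy f (B - A) \<le> energy f B" using A B by (intro energy_mono f) auto
  ultimately show ?thesis by simp
qed

text \<open>This absolute continuity is the source both of countable additivity and of the density.
  For each n a single h n is close to A n in L2 and in energy at once, which reduces the claim to
  \<open>L_fun_tendsto_0\<close>.\<close>

lemma energy_tendsto_0:
  assumes f: "f \<in> D" and A: "\<And>n::nat. A n \<in> Sigma_Algebra.sets M"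
    and lim: "(\<lambda>n. measure M (A n)) \<longlonglongrightarrow> 0"
  shows "(\<lambda>n. energy f (A n)) \<longlonglongrightarrow> 0"
proof -
  define r where "r n = inverse (real (Suc n))" for n
  have r: "r n > 0" for n by (simp add: r_def)
  have r0: "r \<longlonglongrightarrow> 0" unfolding r_def by (rule LIMSEQ_inverse_real_of_nat)
  have "\<exists>h. h \<in> D \<and> (\<forall>x. 0 \<le> h x \<and> h x \<le> 1) \<and> (\<integral>x. (h x - indicator (A n) x)\<^sup>2 \<partial>M) < r n \<and>
      \<bar>L_fun E f h - energy f (A n)\<bar> < r n" for n
  proof -
    obtain h where h: "unit_approx (A n) h" using unit_approx_exists[OF A] by blast
    have "(\<lambda>k. \<integral>x. (h k x - indicator (A n) x)\<^sup>2 \<partial>M) \<longlonglongrightarrow> 0" using h by (simp add: unit_approx_def)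
    hence "eventually (\<lambda>k. (\<integral>x. (h k x - indicator (A n) x)\<^sup>2 \<partial>M) < r n \<and>
        dist (L_fun E f (h k)) (energy f (A n)) < r n) sequentially"
      using r by (intro eventually_conj tendstoD[OF unit_approx_tendsto_energy[OF f A h]] order_tendstoD(2)) auto
    then obtain k where "(\<integral>x. (h k x - indicator (A n) x)\<^sup>2 \<partial>M) < r n \<and>
        dist (L_fun E f (h k)) (energy f (A n)) < r n"
      using eventually_happens' sequentially_bot by blast
    thus ?thesis using h by (intro exI[of _ "h k"]) (simp add: unit_approx_def dist_real_def)
  qed
  hence "\<exists>h. \<forall>n. h n \<in> D \<and> (\<forall>x. 0 \<le> h n x \<and> h n x \<le> 1) \<and> (\<integral>x. (h n x - indicator (A n) x)\<^sup>2 \<partial>M) < r n \<and>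
      \<bar>L_fun E f (h n) - energy f (A n)\<bar> < r n" by (intro choice allI)
  then obtain h where h: "\<And>n. h n \<in> D" "\<And>n x. 0 \<le> h n x \<and> h n x \<le> 1"
    "\<And>n. (\<integral>x. (h n x - indicator (A n) x)\<^sup>2 \<partial>M) < r n" "\<And>n. \<bar>L_fun E f (h n) - energy f (A n)\<bar> < r n"
    by blast+
  have "(\<lambda>n. L_fun E f (h n)) \<longlonglongrightarrow> 0"
  proof (rule L_fun_tendsto_0[OF f h(1), where C=1])
    show "\<bar>h n x\<bar> \<le> 1" for n x using h(2)[of n x] by simp
    have le: "(\<integral>x. (h n x)\<^sup>2 \<partial>M) \<le> 2 * (r n + measure M (A n))" for n
    proof -
      have ind: "sq_integrable (indicator (A n))" using A by (rule sq_integrable_indicator)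
      have "(\<integral>x. (h n x)\<^sup>2 \<partial>M) = (\<integral>x. ((h n x - indicator (A n) x) + indicator (A n) x)\<^sup>2 \<partial>M)" by simp
      also have "\<dots> \<le> 2 * ((\<integral>x. (h n x - indicator (A n) x)\<^sup>2 \<partial>M) + (\<integral>x. (indicator (A n) x)\<^sup>2 \<partial>M))"
        by (intro integral_sq_add_le sq_integrable_diff ind sq_integrable_D[OF h(1)])
      also have "\<dots> \<le> 2 * (r n + measure M (A n))"
        using h(3)[of n] by (simp add: integral_sq_indicator[OF A])
      finally show ?thesis .
    qed
    have "(\<lambda>n. 2 * (r n + measure M (A n))) \<longlonglongrightarrow> 2 * (0 + 0)" by (intro tendsto_intros r0 lim)
    hence lim2: "(\<lambda>n. 2 * (r n + measure M (A n))) \<longlonglongrightarrow> 0" by simp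
    show "(\<lambda>n. \<integral>x. (h n x)\<^sup>2 \<partial>M) \<longlonglongrightarrow> 0"
      by (rule tendsto_sandwich[OF _ _ tendsto_const lim2]) (use le in auto)
  qed
  from tendsto_add[OF this r0] have up: "(\<lambda>n. L_fun E f (h n) + r n) \<longlonglongrightarrow> 0" by simp
  show ?thesis
  proof (rule tendsto_sandwich[OF _ _ tendsto_const up])
    show "\<forall>\<^sub>F n in sequentially. 0 \<le> energy f (A n)" using energy_nonneg[OF f A] by simp
    have "energy f (A n) \<le> L_fun E f (h n) + r n" for n using h(4)[of n] by linarith
    thus "\<forall>\<^sub>F n in sequentially. energy f (A n) \<le> L_fun E f (h n) + r n" by simp
  qed
qed

lemma energy_null:
  assumes "f \<in> D" "A \<in> Sigma_Algebra.sets M" "measure M A = 0"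
  shows "energy f A = 0"
  using energy_tendsto_0[of f "\<lambda>_. A"] assms by (simp add: LIMSEQ_const_iff)

lemma energy_S_eq:
  assumes f: "f \<in> D" and B: "B \<in> S_sets D"
  shows "energy_S E D f B = energy f B"
proof -
  have Bm: "B \<in> Sigma_Algebra.sets M" using B by (rule S_subset_sets)
  obtain a where a: "\<And>n::nat. a n \<in> D" "\<And>n x. 0 \<le> a n x" "\<And>n x. a n x \<le> indicator B x"
    "(\<lambda>n. \<integral>x. (a n x - indicator B x)\<^sup>2 \<partial>M) \<longlonglongrightarrow> 0"
    by (rule S_indicator_approx[OF B]) blast
  have a1: "\<bar>a n x\<bar> \<le> 1" for n x
    using a(2)[of n x] order_trans[OF a(3)[of n x] indicator_le_1] by simp
  have ind: "sq_integrable (indicator B)" using Bm by (rule sq_integrable_indicator)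
  show ?thesis
  proof (rule antisym)
    have "(\<lambda>n. L_fun E f (a n)) \<longlonglongrightarrow> energy f B" by (rule L_fun_tendsto_energy[OF f Bm a(1) a1 a(4)])
    thus "energy f B \<le> energy_S E D f B"
      using L_fun_le_energy_S[OF f a(1-3)] LIMSEQ_le_const2 by blast
    show "energy_S E D f B \<le> energy f B"
    proof (rule energy_S_leI)
      fix h assume h: "h \<in> D" "\<And>x. 0 \<le> h x" "\<And>x. h x \<le> indicator B x"
      \<comment> \<open>A competitor h need not be comparable with a n. But max(h, a n) dominates h
        and lies between a n and the indicator of B, so it still converges to that
        indicator.\<close>
      define m where "m n = (\<lambda>x. max (h x) (a n x))" for n
      have mD: "m n \<in> D" for n using h a by (simp add: m_def)
      have bd: "a n x \<le> m n x" "m n x \<le> indicator B x" for n x using h(3) a(3) by (auto simp: m_def)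
      have "(\<lambda>n. L_fun E f (m n)) \<longlonglongrightarrow> energy f B"
      proof (rule L_fun_tendsto_energy[OF f Bm mD, where C=1])
        show "\<bar>m n x\<bar> \<le> 1" for n x
          using bd[of n x] a(2)[of n x] order_trans[OF bd(2)[of n x] indicator_le_1] by simp
        have "\<bar>m n x - indicator B x\<bar> \<le> \<bar>a n x - indicator B x\<bar>" for n x
          using bd[of n x] by simp
        hence le: "(\<integral>x. (m n x - indicator B x)\<^sup>2 \<partial>M) \<le> (\<integral>x. (a n x - indicator B x)\<^sup>2 \<partial>M)" for n
          by (intro integral_sq_mono sq_integrable_diff ind sq_integrable_D[OF mD] sq_integrable_D[OF a(1)])
        show "(\<lambda>n. \<integral>x. (m n x - indicator B x)\<^sup>2 \<partial>M) \<longlonglongrightarrow> 0"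
          by (rule tendsto_sandwich[OF _ _ tendsto_const a(4)]) (use le in auto)
      qed
      moreover have "L_fun E f h \<le> L_fun E f (m n)" for n
        by (rule L_fun_mono[OF f h(1) mD]) (simp add: m_def)
      ultimately show "L_fun E f h \<le> energy f B" using LIMSEQ_le_const by blast
    qed
  qed
qed

section \<open>Agreement with the energy measure on the generated algebra\<close>

lemma gen_algebra_sets: "A \<in> gen_algebra (S_sets D) \<Longrightarrow> A \<in> Sigma_Algebra.sets M"
proof (induction rule: gen_algebra.induct)
  case (gen_compl A)
  thus ?case using sets.compl_sets[of A M] by (simp add: space Compl_eq_Diff_UNIV)
qed (use S_subset_sets sets.top[of M] space in auto)

text \<open>Two-sided outer regularity, which is stable under complements. For \<open>{x. f x > 0}\<close> the outer
  sets of the complement are \<open>{x. f x < chi0 x / n}\<close>; this replaces the constants missing in \<open>D\<close>.\<close>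

lemma energy_outer_regular:
  assumes f: "f \<in> D" and A: "A \<in> gen_algebra (S_sets D)"
  shows "\<forall>\<epsilon>>0. (\<exists>U\<in>S_sets D. A \<subseteq> U \<and> energy f (U - A) < \<epsilon>) \<and>
    (\<exists>V\<in>S_sets D. - A \<subseteq> V \<and> energy f (V - (- A)) < \<epsilon>)"
  using A
proof (induction rule: gen_algebra.induct)
  case gen_UNIV
  have e: "energy f {} = 0" using f by (intro energy_null) auto
  have "{} \<in> S_sets D" using positive_set_S[OF D_zero] by simp
  thus ?case using UNIV_in_S e by (metis Compl_UNIV_eq Diff_cancel order_refl)
next
  case (gen_base A)
  then obtain p where p: "p \<in> D" "A = {x. p x > 0}" by (auto simp: S_sets_def)
  have e: "energy f {} = 0" using f by (intro energy_null) auto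
  define V where "V n = {x. inverse (real (Suc n)) * chi0 x - p x > 0}" for n
  have V: "V n \<in> S_sets D" for n unfolding V_def using p chi(1) by (intro positive_set_S D_diff D_scale)
  have sub: "- A \<subseteq> V n" for n using chi(2) by (auto simp: V_def p not_less intro: le_less_trans)
  have mV: "V n \<inter> A \<in> Sigma_Algebra.sets M" for n
    using S_subset_sets[OF V] S_subset_sets[OF gen_base] by auto
  have dec: "decseq (\<lambda>n. V n \<inter> A)"
  proof (rule decseq_SucI)
    fix n
    have "inverse (real (Suc (Suc n))) * chi0 x \<le> inverse (real (Suc n)) * chi0 x" for x
      using chi(2) by (intro mult_right_mono) (auto simp: less_imp_le)
    thus "V (Suc n) \<inter> A \<subseteq> V n \<inter> A" by (auto simp: V_def intro: less_le_trans)
  qed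
  have empty: "(\<Inter>n. V n \<inter> A) = {}"
  proof -
    have False if x: "\<And>n. x \<in> V n" "x \<in> A" for x
    proof -
      have "(\<lambda>n. inverse (real (Suc n)) * chi0 x) \<longlonglongrightarrow> 0 * chi0 x"
        by (intro tendsto_intros LIMSEQ_inverse_real_of_nat)
      moreover have "p x \<le> inverse (real (Suc n)) * chi0 x" for n using x(1)[of n] by (simp add: V_def)
      ultimately have "p x \<le> 0 * chi0 x" using LIMSEQ_le_const by blast
      thus False using x(2) by (simp add: p)
    qed
    thus ?thesis by blast
  qed
  have "(\<lambda>n. measure M (V n \<inter> A)) \<longlonglongrightarrow> measure M (\<Inter>n. V n \<inter> A)"
    by (intro finite_Lim_measure_decseq dec) (use mV in auto)
  hence "(\<lambda>n. energy f (V n \<inter> A)) \<longlonglongrightarrow> 0" using mV empty by (intro energy_tendsto_0 f) auto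
  hence "\<exists>n. energy f (V n \<inter> A) < \<epsilon>" if "\<epsilon> > 0" for \<epsilon>
    using order_tendstoD(2)[OF _ that] eventually_happens' sequentially_bot by blast
  hence "\<exists>V\<in>S_sets D. - A \<subseteq> V \<and> energy f (V - (- A)) < \<epsilon>" if "\<epsilon> > 0" for \<epsilon>
    using that V sub by (metis Diff_Compl)
  thus ?case using gen_base e by (auto intro!: bexI[of _ A])
next
  case (gen_compl A)
  \<comment> \<open>The two halves of the claim change places.\<close>
  thus ?case by simp
next
  case (gen_union A B)
  have m: "A \<in> Sigma_Algebra.sets M" "B \<in> Sigma_Algebra.sets M"
    using gen_union(1,2) by (auto intro: gen_algebra_sets)
  show ?case
  proof (intro allI impI)
    fix \<epsilon> :: real assume "\<epsilon> > 0"
    hence e2: "\<epsilon> / 2 > 0" by simp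
    obtain U1 V1 where 1: "U1 \<in> S_sets D" "A \<subseteq> U1" "energy f (U1 - A) < \<epsilon> / 2"
      "V1 \<in> S_sets D" "- A \<subseteq> V1" "energy f (V1 - (- A)) < \<epsilon> / 2"
      using gen_union(3)[rule_format, OF e2] by blast
    obtain U2 V2 where 2: "U2 \<in> S_sets D" "B \<subseteq> U2" "energy f (U2 - B) < \<epsilon> / 2"
      "V2 \<in> S_sets D" "- B \<subseteq> V2" "energy f (V2 - (- B)) < \<epsilon> / 2"
      using gen_union(4)[rule_format, OF e2] by blast
    have m': "U1 \<in> Sigma_Algebra.sets M" "U2 \<in> Sigma_Algebra.sets M" "V1 \<in> Sigma_Algebra.sets M" "V2 \<in> Sigma_Algebra.sets M"
      using 1 2 by (auto intro: S_subset_sets)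
    have "energy f (U1 \<union> U2 - (A \<union> B)) \<le> energy f ((U1 - A) \<union> (U2 - B))"
      using m m' by (intro energy_mono f) auto
    also have "\<dots> \<le> energy f (U1 - A) + energy f (U2 - B)" using m m' by (intro energy_subadditive f) auto
    finally have U: "energy f (U1 \<union> U2 - (A \<union> B)) < \<epsilon>" using 1 2 by simp
    have "energy f (V1 \<inter> V2 - (- (A \<union> B))) \<le> energy f ((V1 - (- A)) \<union> (V2 - (- B)))"
      using m m' by (intro energy_mono f) (auto simp: Diff_eq)
    also have "\<dots> \<le> energy f (V1 - (- A)) + energy f (V2 - (- B))"
      using m m' by (intro energy_subadditive f) (auto simp: Diff_eq)
    finally have V: "energy f (V1 \<inter> V2 - (- (A \<union> B))) < \<epsilon>" using 1 2 by simp
    show "(\<exists>U\<in>S_sets D. A \<union> B \<subseteq> U \<and> energy f (U - (A \<union> B)) < \<epsilon>) \<and>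
        (\<exists>V\<in>S_sets D. - (A \<union> B) \<subseteq> V \<and> energy f (V - (- (A \<union> B))) < \<epsilon>)"
    proof (intro conjI bexI)
      show "A \<union> B \<subseteq> U1 \<union> U2" "- (A \<union> B) \<subseteq> V1 \<inter> V2" using 1(2,5) 2(2,5) by auto
    qed (fact U V S_Un[OF 1(1) 2(1)] S_Int[OF 1(4) 2(4)])+
  qed
qed

text \<open>The two set functions agree on \<open>S_sets D\<close>, so the infimum over outer sets
  is at least the energy by monotonicity and exceeds it by at most \<epsilon> by outer
  regularity.\<close>

lemma energy_measure_eq:
  assumes f: "f \<in> D" and A: "A \<in> gen_algebra (S_sets D)"
  shows "energy_measure E D f A = energy f A"
proof (rule antisym)
  have m: "A \<in> Sigma_Algebra.sets M" using A by (rule gen_algebra_sets)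
  show "energy f A \<le> energy_measure E D f A"
  proof (rule energy_measure_greatest)
    fix B assume B: "B \<in> S_sets D" "A \<subseteq> B"
    have "energy f A \<le> energy f B" using B m S_subset_sets[OF B(1)] by (intro energy_mono f)
    thus "energy f A \<le> energy_S E D f B" using energy_S_eq[OF f B(1)] by simp
  qed
  show "energy_measure E D f A \<le> energy f A"
  proof (rule field_le_epsilon)
    fix \<epsilon> :: real assume "\<epsilon> > 0"
    then obtain U where U: "U \<in> S_sets D" "A \<subseteq> U" "energy f (U - A) < \<epsilon>"
      using energy_outer_regular[OF f A] by blast
    have "energy_measure E D f A \<le> energy f U"
      using energy_measure_le[OF f U(1,2)] energy_S_eq[OF f U(1)] by simp
    also have "\<dots> = energy f A + energy f (U - A)" using U m S_subset_sets[OF U(1)] by (intro energy_split f)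
    finally show "energy_measure E D f A \<le> energy f A + \<epsilon>" using U by simp
  qed
qed

section \<open>Countable additivity and the Radon-Nikodym density\<close>

lemma energy_countably_additive:
  assumes f: "f \<in> D"
  shows "countably_additive (Sigma_Algebra.sets M) (\<lambda>A. ennreal (energy f A))"
proof (rule sets.empty_continuous_imp_countably_additive)
  show "positive (Sigma_Algebra.sets M) (\<lambda>A. ennreal (energy f A))"
    using energy_null[OF f, of "{}"] by (simp add: positive_def)
  show "Measure_Space.additive (Sigma_Algebra.sets M) (\<lambda>A. ennreal (energy f A))"
    using energy_Un[OF f] energy_nonneg[OF f] by (auto simp: Measure_Space.additive_def ennreal_plus)
  show "\<forall>A\<in>Sigma_Algebra.sets M. ennreal (energy f A) \<noteq> \<infinity>" by simp
next
  fix A :: "nat \<Rightarrow> 'a set"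
  assume A: "range A \<subseteq> Sigma_Algebra.sets M" "decseq A" "(\<Inter>i. A i) = {}"
  \<comment> \<open>For a finite additive set function continuity at the empty set is enough; it is
    inherited from \<open>M\<close> by absolute continuity.\<close>
  have "(\<lambda>n. measure M (A n)) \<longlonglongrightarrow> 0" using finite_Lim_measure_decseq[OF A(1,2)] A(3) by simp
  hence "(\<lambda>n. energy f (A n)) \<longlonglongrightarrow> 0" using A by (intro energy_tendsto_0 f) auto
  from tendsto_ennrealI[OF this] show "(\<lambda>n. ennreal (energy f (A n))) \<longlonglongrightarrow> 0" by simp
qed

lemma carre_du_champ: "has_carre_du_champ E D M"
  unfolding has_carre_du_champ_def
proof
  fix f assume f: "f \<in> D"
  define N where "N = measure_of UNIV (Sigma_Algebra.sets M) (\<lambda>A. ennreal (energy f A))"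
  have sigma: "sigma_algebra UNIV (Sigma_Algebra.sets M)"
    using sets.sigma_algebra_axioms[of M] by (simp add: space)
  have sN: "Sigma_Algebra.sets N = Sigma_Algebra.sets M"
    using sigma_algebra.sets_measure_of_eq[OF sigma] by (simp add: N_def)
  have eN: "emeasure N A = ennreal (energy f A)" if "A \<in> Sigma_Algebra.sets M" for A
    unfolding N_def using energy_null[OF f, of "{}"] that
    by (intro emeasure_measure_of_sigma[OF sigma _ energy_countably_additive[OF f]])
      (simp_all add: positive_def)
  have "absolutely_continuous M N"
    unfolding absolutely_continuous_def
  proof
    fix A assume "A \<in> null_sets M"
    hence A: "A \<in> Sigma_Algebra.sets M" "measure M A = 0" by (auto simp: null_sets_def measure_def)
    show "A \<in> null_sets N" using A eN[OF A(1)] energy_null[OF f A] by (auto simp: null_sets_def sN)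
  qed
  then obtain g where g: "g \<in> borel_measurable M" "density M g = N"
    using Radon_Nikodym[OF _ sN] by blast
  have "emeasure N UNIV = (\<integral>\<^sup>+x. g x \<partial>M)"
    using emeasure_density[OF g(1), of UNIV] g(2) sets.top[of M] by (simp add: space)
  hence fin_g: "(\<integral>\<^sup>+x. g x \<partial>M) \<noteq> \<infinity>" using eN[of UNIV] sets.top[of M] by (simp add: space)
  have AE_fin: "AE x in M. g x \<noteq> \<infinity>" by (rule nn_integral_PInf_AE[OF g(1) fin_g])
  \<comment> \<open>The density g has extended values. Its integral is the finite total energy, so
    \<open>enn2real\<close> changes it on a null set only and makes it real and nonnegative
    everywhere.\<close>
  define G where "G = (\<lambda>x. enn2real (g x))"
  have [measurable]: "g \<in> borel_measurable M" by (rule g(1))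
  have Gm [measurable]: "G \<in> borel_measurable M" by (simp add: G_def)
  have AE: "AE x in M. ennreal (G x) = g x"
    using AE_fin by eventually_elim (simp add: G_def less_top)
  have "density M (\<lambda>x. ennreal (G x)) = N"
    unfolding g(2)[symmetric] by (rule density_cong) (use AE in auto)
  moreover have "integrable M G"
  proof (rule integrableI_nonneg)
    show "AE x in M. 0 \<le> G x" by (simp add: G_def)
    show "(\<integral>\<^sup>+x. ennreal (G x) \<partial>M) < \<infinity>"
      using nn_integral_cong_AE[OF AE] fin_g by (simp add: less_top)
  qed measurable
  moreover have "emeasure N A = ennreal (energy_measure E D f A)" if "A \<in> gen_algebra (S_sets D)" for A
    using eN[OF gen_algebra_sets[OF that]] energy_measure_eq[OF f that] by simp
  ultimately show "\<exists>\<nu> g. Sigma_Algebra.sets \<nu> = Sigma_Algebra.sets M \<and>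
        (\<forall>A\<in>gen_algebra (S_sets D). emeasure \<nu> A = ennreal (energy_measure E D f A)) \<and>
        integrable M g \<and> (\<forall>x. g x \<ge> 0) \<and> \<nu> = density M (\<lambda>x. ennreal (g x))"
    using sN by (intro exI[of _ N] exI[of _ G]) (auto simp: G_def)
qed

end

theorem theoremT:
  fixes D :: "('a \<Rightarrow> real) set"
    and E :: "('a \<Rightarrow> real) \<Rightarrow> ('a \<Rightarrow> real) \<Rightarrow> real"
    and chi0 :: "'a \<Rightarrow> real"
    and M :: "'a measure"
  assumes alg: "bounded_fun_algebra D"
    and stable: "C1c_stable D"
    and chi: "chi0 \<in> D" "\<forall>x. chi0 x > 0"
    and form: "bilinear_form E D"
    and closable: "sup_norm_closable E D"
    and contr: "contractions_operate E D"
    and space: "space M = UNIV"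
    and sets: "sets M = sigma_D D"
    and fin: "finite_measure M"
    and dom: "energy_dominant E D M"
  shows "L2_closable E D M \<and> closure_is_Dirichlet E D M \<and> has_carre_du_champ E D M"
proof -
  interpret dominated_form D E chi0 M
    by (intro dominated_form.intro contraction_form.intro dominated_form_axioms.intro; fact)
  show ?thesis using L2_closable[OF closable] closure_Dirichlet carre_du_champ by blast
qed

end
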